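(* Assume that $\gamma$ is tangentially graph-like for $\hat r>0$ (and thus for all $r\le\hat r$), and fix $\hat s\in[0,L]$. If we know $g(s,r)$, $g_s(s,r)=\frac{\partial g(s,r)}{\partial s}$ and $g_r(s,r)=\frac{\partial g(s,r)}{\partial r}$ for all $(s,r)\in([0,L]\times\{\hat r\})\cup(\{\hat s\}\times(0,\hat r])$, then we can reconstruct $\gamma(s)\in\mathbb R^2$ for all $s\in[0,L]$ modulo reparametrizations, translations and rotations. (That is, two such curves with the same $L$, $\hat r$, $\hat s$ and identical data on this set coincide up to reparametrization, translation and rotation.)
   Context: $\Omega\subset\mathbb R^2$ is a compact set with simple closed continuously differentiable boundary $\partial\Omega$ of length $L$; $\gamma:[0,L]\to\partial\Omega$ is a continuous counterclockwise arclength parameterization with $\gamma(0)=\gamma(L)$; $D(p,r)$ is the closed disk of radius $r$ about $p$; $g(s,r)=\operatorname{Area}(\Omega\cap D(\gamma(s),r))$. $\partial\Omega$ (or $\gamma$) is tangentially graph-like (TGL) at $p\in\partial\Omega$ for radius $r$ if $\partial\Omega$ is continuously differentiable and there is a Cartesian coordinate system with origin $p$ in which $\partial\Omega\cap D(p,r)$ is the graph of a function $f$ with $f(0)=0$ and $f'(0)=0$; it is TGL for radius $r$ if this holds at every $p\in\partial\Omega$. *)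

theory Defs
  imports "HOL-Complex_Analysis.Complex_Analysis"
begin

text \<open>The plane is the type \<^typ>\<open>complex\<close>. The library's paths live on \<open>{0..1}\<close>, so a curve
  on \<open>{0..L}\<close> is rescaled before library notions are applied to it.\<close>

definition unit_rescale :: "real \<Rightarrow> (real \<Rightarrow> complex) \<Rightarrow> real \<Rightarrow> complex" where
  "unit_rescale L \<gamma> = (\<lambda>t. \<gamma> (L * t))"

text \<open>\<open>\<gamma>\<close> is a unit-speed continuously differentiable closed curve on \<open>{0..L}\<close>; the condition
  \<open>\<gamma>' 0 = \<gamma>' L\<close> makes it continuously differentiable across the base point as well.\<close>

definition C1_arclength_loop :: "real \<Rightarrow> (real \<Rightarrow> complex) \<Rightarrow> bool" where
  "C1_arclength_loop L \<gamma> \<longleftrightarrow> 0 < L \<and> \<gamma> 0 = \<gamma> L \<and>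
     (\<exists>\<gamma>'. continuous_on {0..L} \<gamma>' \<and> \<gamma>' 0 = \<gamma>' L \<and>
        (\<forall>s\<in>{0..L}. (\<gamma> has_vector_derivative \<gamma>' s) (at s within {0..L}) \<and> norm (\<gamma>' s) = 1))"

text \<open>The condition \<open>interior \<Omega> \<noteq> {}\<close> only excludes the degenerate case that \<open>\<Omega>\<close> is the curve
  itself, which is a compact set with that curve as its frontier. By the Jordan curve theorem,
  \<open>\<Omega>\<close> is then the curve together with its inside.\<close>

definition ccw_arclength_boundary :: "complex set \<Rightarrow> real \<Rightarrow> (real \<Rightarrow> complex) \<Rightarrow> bool" where
  "ccw_arclength_boundary \<Omega> L \<gamma> \<longleftrightarrow>
     compact \<Omega> \<and> interior \<Omega> \<noteq> {} \<and>
     C1_arclength_loop L \<gamma> \<and>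
     simple_path (unit_rescale L \<gamma>) \<and>
     path_image (unit_rescale L \<gamma>) = frontier \<Omega> \<and>
     (\<forall>z\<in>interior \<Omega>. winding_number (unit_rescale L \<gamma>) z = 1)"

text \<open>\<open>e1\<close>, \<open>e2\<close> are the axis directions of a Cartesian coordinate system with origin \<open>p\<close>, and \<open>A\<close>
  is the domain of the function whose graph is taken.\<close>

definition TGL_at :: "complex set \<Rightarrow> complex \<Rightarrow> real \<Rightarrow> bool" where
  "TGL_at C p r \<longleftrightarrow>
     (\<exists>e1 e2 A f. norm e1 = 1 \<and> norm e2 = 1 \<and> e1 \<bullet> e2 = 0 \<and>
        0 \<in> interior A \<and> f 0 = 0 \<and> (f has_real_derivative 0) (at 0) \<and>
        C \<inter> cball p r = (\<lambda>x. p + x *\<^sub>R e1 + f x *\<^sub>R e2) ` A)"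

definition TGL :: "complex set \<Rightarrow> real \<Rightarrow> bool" where
  "TGL C r \<longleftrightarrow> (\<forall>p\<in>C. TGL_at C p r)"

definition disk_area :: "complex set \<Rightarrow> (real \<Rightarrow> complex) \<Rightarrow> real \<Rightarrow> real \<Rightarrow> real" where
  "disk_area \<Omega> \<gamma> s r = measure lebesgue (\<Omega> \<inter> cball (\<gamma> s) r)"

text \<open>Since \<open>\<gamma>\<close> matters only on \<open>{0..L}\<close>, the derivative in \<open>s\<close> is one-sided at the two ends.\<close>

definition disk_area_ds :: "complex set \<Rightarrow> real \<Rightarrow> (real \<Rightarrow> complex) \<Rightarrow> real \<Rightarrow> real \<Rightarrow> real" where
  "disk_area_ds \<Omega> L \<gamma> s r = vector_derivative (\<lambda>t. disk_area \<Omega> \<gamma> t r) (at s within {0..L})"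

definition disk_area_dr :: "complex set \<Rightarrow> (real \<Rightarrow> complex) \<Rightarrow> real \<Rightarrow> real \<Rightarrow> real" where
  "disk_area_dr \<Omega> \<gamma> s r = vector_derivative (\<lambda>\<rho>. disk_area \<Omega> \<gamma> s \<rho>) (at r)"

definition reparametrization :: "real \<Rightarrow> (real \<Rightarrow> real) \<Rightarrow> bool" where
  "reparametrization L \<phi> \<longleftrightarrow>
     continuous_on {0..L} \<phi> \<and> strict_mono_on {0..L} \<phi> \<and> \<phi> ` {0..L} = {0..L}"

end

theory Submission
  imports Defs
begin

text \<open>
  Write the area as the integral of the winding number over the disk and exchange the order of
  integration: since the Cauchy transform of the disk \<open>D(c,r)\<close> at \<open>w\<close> is
  \<open>\<pi> min(|w - c|, r)\<^sup>2 / (w - c)\<close>, this expresses \<open>g(s,r)\<close> as a curve integral of an explicit Lipschitz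
  kernel in \<open>\<gamma> t - \<gamma> s\<close>, which can be differentiated in \<open>r\<close> and in \<open>s\<close>.

  The graph condition implies that no chord of length at most \<open>rhat\<close> is orthogonal to the tangent
  at one of its ends: its far end would lie over the origin of the coordinate system. Hence the distance from \<open>\<gamma> s\<close> has no critical point at
  height at most \<open>rhat\<close>, and every circle of radius \<open>r \<le> rhat\<close> about \<open>\<gamma> s\<close> meets the curve in exactly two
  points, with relative positions \<open>w\<^sub>1\<close> (forward) and \<open>w\<^sub>2\<close> (backward). The derivatives then evaluate to
  \<open>exp (i g\<^sub>r / r) = w\<^sub>2 / w\<^sub>1\<close> and \<open>g\<^sub>s = Im (cnj T (w\<^sub>2 - w\<^sub>1))\<close>. As \<open>w\<^sub>1\<close> and \<open>w\<^sub>2\<close> lie on opposite sides of the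
  normal, these two numbers determine \<open>w\<^sub>1\<close> relative to the tangent \<open>T\<close>.

  At \<open>shat\<close> this recovers the arc up to the first exit from the disk of radius \<open>rhat\<close>. Sliding the disk along
  the part already known recovers the next part, because the exit point is known relative to the
  tangent frame at the centre. Two unit speed parametrizations of the same arc differ by a constant
  shift, so the curves agree for the identity reparametrization.
\<close>

section \<open>The Cauchy transform of a disk\<close>

text \<open>It suffices to compare boxes. The preimage of a box is its image under the inverse map,
  again orthogonal, and orthogonal images keep their Lebesgue measure.\<close>

lemma distr_lborel_orthogonal_transformation:
  fixes f :: "real^'n::{finite,wellorder} \<Rightarrow> real^'n::_"
  assumes f: "orthogonal_transformation f"
  shows "distr lborel borel f = lborel"
proof (rule sym, rule lborel_eqI)
  fix l u :: "real^'n::{finite,wellorder}"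
  assume le: "\<And>b. b \<in> Basis \<Longrightarrow> l \<bullet> b \<le> u \<bullet> b"
  have lin: "linear f" using f by (rule orthogonal_transformation_linear)
  have meas: "f \<in> borel_measurable borel"
    using lin by (intro borel_measurable_continuous_onI linear_continuous_on linear_conv_bounded_linear[THEN iffD1])
  have inj: "inj f" using f by (rule orthogonal_transformation_inj)
  define g where "g = inv f"
  have g: "orthogonal_transformation g" 
    unfolding g_def using f by (rule orthogonal_transformation_inv)
  have vi: "f -` box l u = g ` box l u"
    unfolding g_def using f by (simp add: bij_vimage_eq_inv_image orthogonal_transformation_bij)
  have lm: "box l u \<in> lmeasurable" by simp
  have vs: "f -` box l u \<in> sets borel"
    using measurable_sets_borel[OF meas] by simp
  have "emeasure (distr lborel borel f) (box l u) = emeasure lborel (f -` box l u)"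
    using meas by (simp add: emeasure_distr)
  also have "\<dots> = emeasure lebesgue (g ` box l u)"
    using vs by (simp add: vi)
  also have "\<dots> = ennreal (measure lebesgue (g ` box l u))"
    using measurable_orthogonal_image[OF g lm] by (simp add: emeasure_eq_measure2)
  also have "\<dots> = ennreal (measure lebesgue (box l u))"
    using measure_orthogonal_image[OF g lm] by simp
  also have "\<dots> = (\<Prod>b\<in>Basis. (u - l) \<bullet> b)"
    using le by (simp add: measure_lborel_box_eq)
  finally show "emeasure (distr lborel borel f) (box l u) = (\<Prod>b\<in>Basis. (u - l) \<bullet> b)" .
qed simp

definition vec_of_complex :: "complex \<Rightarrow> real^2" where
  "vec_of_complex z = vector [Re z, Im z]"

definition complex_of_vec :: "real^2 \<Rightarrow> complex" where
  "complex_of_vec v = Complex (v $ 1) (v $ 2)"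

lemma distr_lborel_complex_of_vec: "distr lborel borel complex_of_vec = lborel"
proof (rule sym, rule lborel_eqI)
  fix l u :: complex
  assume le: "\<And>b. b \<in> Basis \<Longrightarrow> l \<bullet> b \<le> u \<bullet> b"
  have le': "Re l \<le> Re u" "Im l \<le> Im u" using le[of 1] le[of \<i>] by (auto simp: Basis_complex_def)
  have meas: "complex_of_vec \<in> borel_measurable borel"
    unfolding complex_of_vec_def Complex_eq by measurable
  have vi: "complex_of_vec -` box l u = box (vec_of_complex l) (vec_of_complex u)"
    by (auto simp: complex_of_vec_def vec_of_complex_def box_def Basis_complex_def Basis_vec_def inner_axis forall_2)
  have "emeasure (distr lborel borel complex_of_vec) (box l u) = emeasure lborel (complex_of_vec -` box l u)"
    using meas by (simp add: emeasure_distr)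
  also have "\<dots> = ennreal (\<Prod>b\<in>Basis. (vec_of_complex u - vec_of_complex l) \<bullet> b)"
    unfolding vi
  proof (rule emeasure_lborel_box)
    have "vec_of_complex l $ i \<le> vec_of_complex u $ i" for i
      using le' exhaust_2[of i] by (auto simp: vec_of_complex_def)
    then show "vec_of_complex l \<bullet> b \<le> vec_of_complex u \<bullet> b" if "b \<in> Basis" for b
      using that by (auto simp: Basis_vec_def inner_axis)
  qed
  also have "(\<Prod>b\<in>Basis. (vec_of_complex u - vec_of_complex l) \<bullet> b) = (Re u - Re l) * (Im u - Im l)"
  proof -
    have B: "(Basis :: (real^2) set) = {axis 1 1, axis 2 1}" by (auto simp: Basis_vec_def UNIV_2)
    show ?thesis unfolding B by (simp add: axis_eq_axis vec_of_complex_def inner_axis)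
  qed
  also have "\<dots> = (\<Prod>b\<in>Basis. (u - l) \<bullet> b)"
    by (simp add: Basis_complex_def complex_eq_iff)
  finally show "emeasure (distr lborel borel complex_of_vec) (box l u) = (\<Prod>b\<in>Basis. (u - l) \<bullet> b)" .
qed simp

text \<open>In the coordinates of \<open>real^2\<close> the multiplication becomes the orthogonal
  map \<open>f\<close>; the identity \<open>comp\<close> carries its invariance back to the
  plane.\<close>

lemma distr_lborel_mult_unit_complex:
  assumes u: "cmod u = 1"
  shows "distr lborel borel ((*) u) = lborel"
proof -
  define f where "f = (\<lambda>v. vec_of_complex (u * complex_of_vec v))"
  have nv: "norm (vec_of_complex z) = cmod z" for z
    by (simp add: norm_vec_def L2_set_def vec_of_complex_def cmod_def UNIV_2)
  have nc: "cmod (complex_of_vec v) = norm v" for v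
    by (simp add: norm_vec_def L2_set_def complex_of_vec_def cmod_def UNIV_2)
  have "linear f"
    by (rule linearI) (auto simp: f_def vec_eq_iff forall_2 vec_of_complex_def complex_of_vec_def algebra_simps)
  then have "orthogonal_transformation f"
    using u by (simp add: orthogonal_transformation f_def nv nc norm_mult)
  then have df: "distr lborel borel f = lborel"
    by (rule distr_lborel_orthogonal_transformation)
  have mc: "complex_of_vec \<in> borel_measurable borel"
    unfolding complex_of_vec_def Complex_eq by measurable
  have "linear f" by fact
  then have mf: "f \<in> borel_measurable borel"
    by (intro borel_measurable_continuous_onI linear_continuous_on linear_conv_bounded_linear[THEN iffD1])
  have comp: "(*) u \<circ> complex_of_vec = complex_of_vec \<circ> f"
    by (auto simp: fun_eq_iff f_def complex_of_vec_def vec_of_complex_def complex_eq_iff)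
  have "distr lborel borel ((*) u) = distr (distr lborel borel complex_of_vec) borel ((*) u)"
    by (simp add: distr_lborel_complex_of_vec)
  also have "\<dots> = distr lborel borel (complex_of_vec \<circ> f)"
    using mc by (subst distr_distr) (auto simp: comp)
  also have "\<dots> = distr (distr lborel borel f) borel complex_of_vec"
    using mc mf by (subst distr_distr) auto
  also have "\<dots> = lborel"
    by (simp add: df distr_lborel_complex_of_vec)
  finally show ?thesis .
qed

section \<open>Integrability of the Cauchy kernel over disks\<close>

text \<open>Layer cake: \<open>1 / |z|\<close> is the length of the set of \<open>t > 0\<close> with \<open>t |z| < 1\<close>.\<close>

lemma nn_integral_inverse_norm_ball:
  "(\<integral>\<^sup>+z. ennreal (1 / cmod z) * indicator (ball 0 1) z \<partial>lborel) \<le> ennreal (2 * pi)"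
proof -
  have "(\<integral>\<^sup>+z. ennreal (1 / cmod z) * indicator (ball 0 1) z \<partial>lborel)
      = (\<integral>\<^sup>+z. \<integral>\<^sup>+t. indicator {0<..} t * indicator (ball 0 1 \<inter> {z. t * cmod z < 1} - {0}) z \<partial>lborel \<partial>lborel)"
  proof (rule nn_integral_cong_AE, rule AE_I)
    show "{z \<in> space lborel. \<not> (ennreal (1 / cmod z) * indicator (ball 0 1) z = (\<integral>\<^sup>+t. indicator {0<..} t * indicator (ball 0 1 \<inter> {z. t * cmod z < 1} - {0}) z \<partial>lborel))} \<subseteq> {}"
    proof (safe)
      fix z :: complex
      assume H: "ennreal (1 / cmod z) * indicator (ball 0 1) z \<noteq> (\<integral>\<^sup>+t. indicator {0<..} t * indicator (ball 0 1 \<inter> {z. t * cmod z < 1} - {0}) z \<partial>lborel)"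
      show "z \<in> {}"
      proof (cases "z = 0")
        case True with H show ?thesis by simp
      next
        case False
        have "(\<integral>\<^sup>+t. indicator {0<..} t * indicator (ball 0 1 \<inter> {z. t * cmod z < 1} - {0}) z \<partial>lborel)
          = (\<integral>\<^sup>+t. indicator (ball 0 1) z * indicator {0<..<1 / cmod z} t \<partial>lborel)"
          using False by (intro nn_integral_cong) (auto simp: indicator_def field_simps)
        also have "\<dots> = ennreal (1 / cmod z) * indicator (ball 0 1) z"
          by (simp add: nn_integral_cmult mult.commute)
        finally show ?thesis using H by simp
      qed
    qed
  qed auto
  also have "\<dots> = (\<integral>\<^sup>+t. \<integral>\<^sup>+z. indicator {0<..} t * indicator (ball 0 1 \<inter> {z. t * cmod z < 1} - {0}) z \<partial>lborel \<partial>lborel)"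
  proof (rule lborel_pair.Fubini'[symmetric])
    have "{x \<in> space (lborel \<Otimes>\<^sub>M lborel). (case x of (z::complex, t::real) \<Rightarrow> 0 < t \<and> cmod z < 1 \<and> t * cmod z < 1 \<and> z \<noteq> 0)} \<in> sets (lborel \<Otimes>\<^sub>M lborel)"
      by measurable
    then have "(indicator {x \<in> space (lborel \<Otimes>\<^sub>M lborel). (case x of (z::complex, t::real) \<Rightarrow> 0 < t \<and> cmod z < 1 \<and> t * cmod z < 1 \<and> z \<noteq> 0)} :: _ \<Rightarrow> ennreal) \<in> borel_measurable (lborel \<Otimes>\<^sub>M lborel)"
      by (rule borel_measurable_indicator)
    also have "indicator {x \<in> space (lborel \<Otimes>\<^sub>M lborel). (case x of (z::complex, t::real) \<Rightarrow> 0 < t \<and> cmod z < 1 \<and> t * cmod z < 1 \<and> z \<noteq> 0)}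
       = (\<lambda>(x, y). indicator {0<..} y * indicator (ball 0 1 \<inter> {z. y * cmod z < 1} - {0}) x :: ennreal)"
      by (auto simp: fun_eq_iff indicator_def space_pair_measure)
    finally show "(\<lambda>(x, y). indicator {0<..} y * indicator (ball 0 1 \<inter> {z. y * cmod z < 1} - {0}) x :: ennreal) \<in> borel_measurable (lborel \<Otimes>\<^sub>M lborel)" .
  qed
  \<comment> \<open>The slice at height \<open>t\<close> lies in the disk of radius 1 if
    \<open>t < 1\<close> and of radius \<open>1 / t\<close> otherwise, so its area is at most
    \<open>pi\<close> or \<open>pi / t\<^sup>2\<close> respectively.\<close>
  also have "\<dots> \<le> (\<integral>\<^sup>+t. ennreal pi * (indicator {0<..<1} t + ennreal (1 / t\<^sup>2) * indicator {1..} t) \<partial>lborel)"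
  proof (rule nn_integral_mono)
    fix t :: real
    let ?S = "ball 0 1 \<inter> {z::complex. t * cmod z < 1} - {0}"
    have mS: "?S \<in> sets lborel" by measurable
    have eq: "(\<integral>\<^sup>+z. indicator {0<..} t * indicator ?S z \<partial>lborel) = indicator {0<..} t * emeasure lborel ?S"
      using mS by (simp add: nn_integral_cmult_indicator)
    show "(\<integral>\<^sup>+z. indicator {0<..} t * indicator ?S z \<partial>lborel)
      \<le> ennreal pi * (indicator {0<..<1} t + ennreal (1 / t\<^sup>2) * indicator {1..} t)"
    proof (cases "0 < t")
      case False then show ?thesis by simp
    next
      case True
      show ?thesis
      proof (cases "t < 1")
        case True
        have "emeasure lborel ?S \<le> emeasure lborel (cball (0::complex) 1)"
          by (intro emeasure_mono) auto
        also have "\<dots> = ennreal pi" by (subst emeasure_cball) (auto simp: eval_unit_ball_vol)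
        finally show ?thesis unfolding eq using True \<open>0 < t\<close> by simp
      next
        case False
        have "emeasure lborel ?S \<le> emeasure lborel (cball (0::complex) (1/t))"
          using \<open>0 < t\<close> by (intro emeasure_mono) (auto simp: field_simps)
        also have "\<dots> = ennreal (pi * (1/t\<^sup>2))" using \<open>0 < t\<close> by (subst emeasure_cball) (auto simp: eval_unit_ball_vol power_divide)
        finally show ?thesis unfolding eq using False \<open>0 < t\<close>
          by (simp add: ennreal_mult' flip: ennreal_mult)
      qed
    qed
  qed
  also have "\<dots> = ennreal pi * (1 + (\<integral>\<^sup>+t. ennreal (1 / t\<^sup>2) * indicator {1..} t \<partial>lborel))"
    by (simp add: nn_integral_cmult nn_integral_add)
  also have "(\<integral>\<^sup>+t. ennreal (1 / t\<^sup>2) * indicator {1..} t \<partial>lborel) = ennreal (0 - (- 1 / 1))"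
  proof (rule nn_integral_FTC_atLeast[where F = "\<lambda>x. - 1 / x"])
    show "((\<lambda>x::real. - 1 / x) \<longlongrightarrow> 0) at_top" by real_asymp
    fix x :: real assume "1 \<le> x"
    then show "((\<lambda>x. - 1 / x) has_real_derivative 1 / x\<^sup>2) (at x)"
      by (auto intro!: derivative_eq_intros simp: power2_eq_square)
  qed auto
  also have "ennreal pi * (1 + ennreal (0 - (- 1 / 1))) = ennreal (2 * pi)"
    by (simp add: ennreal_mult' mult.commute)
  finally show ?thesis .
qed

lemma cball_borel [measurable]: "cball (c :: 'a :: metric_space) r \<in> sets borel"
  by (simp add: borel_closed)

lemma ball_borel [measurable]: "ball (c :: 'a :: metric_space) r \<in> sets borel"
  by (simp add: borel_open)

text \<open>Farther than 1 from \<open>w\<close> the integrand is at most 1 and the area of the disk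
  bounds the integral; nearer, a translation reduces to the previous bound. Independence of
  \<open>w\<close> is what makes it a majorant for Fubini.\<close>

lemma nn_integral_inverse_norm_cball:
  fixes w c :: complex
  assumes "0 \<le> r"
  shows "(\<integral>\<^sup>+z. ennreal (1 / cmod (w - z)) * indicator (cball c r) z \<partial>lborel) \<le> ennreal (pi * r\<^sup>2 + 2 * pi)"
proof -
  have "(\<integral>\<^sup>+z. ennreal (1 / cmod (w - z)) * indicator (cball c r) z \<partial>lborel)
     \<le> (\<integral>\<^sup>+z. indicator (cball c r) z + ennreal (1 / cmod (z - w)) * indicator (ball 0 1) (z - w) \<partial>lborel)"
  proof (rule nn_integral_mono)
    fix z :: complex
    show "ennreal (1 / cmod (w - z)) * indicator (cball c r) z
      \<le> indicator (cball c r) z + ennreal (1 / cmod (z - w)) * indicator (ball 0 1) (z - w)"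
      by (cases "cmod (z - w) < 1")
         (auto simp: indicator_def norm_minus_commute divide_le_eq intro!: ennreal_le_1[THEN iffD2])
  qed
  also have "\<dots> = emeasure lborel (cball c r) + (\<integral>\<^sup>+z. ennreal (1 / cmod (z - w)) * indicator (ball 0 1) (z - w) \<partial>lborel)"
    by (subst nn_integral_add) auto
  also have "(\<integral>\<^sup>+z. ennreal (1 / cmod (z - w)) * indicator (ball 0 1) (z - w) \<partial>lborel)
    = (\<integral>\<^sup>+z. ennreal (1 / cmod z) * indicator (ball 0 1) z \<partial>distr lborel borel ((+) (-w)))"
    by (subst nn_integral_distr) auto
  also have "distr lborel borel ((+) (-w)) = lborel" by (rule lborel_distr_plus)
  also have "emeasure lborel (cball c r) + (\<integral>\<^sup>+z. ennreal (1 / cmod z) * indicator (ball 0 1) z \<partial>lborel)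
     \<le> ennreal (pi * r\<^sup>2) + ennreal (2 * pi)"
    using nn_integral_inverse_norm_ball assms
    by (intro add_mono) (auto simp: emeasure_cball eval_unit_ball_vol)
  finally show ?thesis using assms by (simp add: ennreal_plus)
qed

section \<open>Circle averages of the Cauchy kernel\<close>

text \<open>The denominator is \<open>w * (1 - q * exp (\<i> * x))\<close> with
  \<open>cmod q < 1\<close>, which keeps the second factor off the cut of the logarithm. So
  \<open>(x + \<i> * Ln (1 - q * exp (\<i> * x))) / w\<close> is a primitive on the whole circle;
  its periodic part cancels and the linear part gives \<open>2 * pi / w\<close>.\<close>

lemma integral_circle_inverse_inside:
  fixes w z :: complex
  assumes "cmod z < cmod w"
  shows "((\<lambda>\<theta>. 1 / (w - cis \<theta> * z)) has_integral 2 * pi / w) {0..2*pi}"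
proof -
  define q where "q = z / w"
  have w: "w \<noteq> 0" using assms by auto
  have q: "cmod q < 1" unfolding q_def using assms w by (simp add: norm_divide)
  have re: "1 - q * exp (\<i> * of_real x) \<notin> \<real>\<^sub>\<le>\<^sub>0" for x :: real
  proof -
    have "cmod (q * exp (\<i> * of_real x)) < 1" using q by (simp add: norm_mult)
    then have "Re (q * exp (\<i> * of_real x)) < 1" using complex_Re_le_cmod[of "q * exp (\<i> * of_real x)"] by linarith
    then show ?thesis by (simp add: complex_nonpos_Reals_iff)
  qed
  have "((\<lambda>x. 1 / (w - cis x * z)) has_integral
     ((of_real (2*pi) + \<i> * Ln (1 - q * exp (\<i> * of_real (2*pi)))) / w - (of_real 0 + \<i> * Ln (1 - q * exp (\<i> * of_real 0))) / w)) {0..2*pi}"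
  proof (rule fundamental_theorem_of_calculus)
    fix x :: real assume "x \<in> {0..2*pi}"
    have nz: "1 - q * exp (\<i> * of_real x) \<noteq> 0" using re[of x] by auto
    have "((\<lambda>x. (x + \<i> * Ln (1 - q * exp (\<i> * x))) / w) has_field_derivative
         (1 + \<i> * ((- (q * (\<i> * exp (\<i> * of_real x)))) / (1 - q * exp (\<i> * of_real x)))) / w) (at (of_real x))"
      using re[of x] w by (auto intro!: derivative_eq_intros simp: field_simps)
    moreover have "(1 + \<i> * ((- (q * (\<i> * exp (\<i> * of_real x)))) / (1 - q * exp (\<i> * of_real x)))) / w = 1 / (w - cis x * z)"
    proof -
      have "w - cis x * z = w * (1 - q * exp (\<i> * of_real x))"
        using w by (simp add: q_def cis_conv_exp field_simps)
      moreover have "1 + \<i> * ((- (q * (\<i> * exp (\<i> * of_real x)))) / (1 - q * exp (\<i> * of_real x))) = 1 / (1 - q * exp (\<i> * of_real x))"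
        using nz by (simp add: field_simps)
      ultimately show ?thesis by simp
    qed
    ultimately have "((\<lambda>x. (x + \<i> * Ln (1 - q * exp (\<i> * x))) / w) has_field_derivative 1 / (w - cis x * z)) (at (of_real x))" by simp
    from has_vector_derivative_real_field[OF this]
    show "((\<lambda>x. (of_real x + \<i> * Ln (1 - q * exp (\<i> * of_real x))) / w) has_vector_derivative 1 / (w - cis x * z)) (at x within {0..2*pi})" .
  qed simp
  then show ?thesis
    using exp_two_pi_i' by (simp add: mult.commute mult.assoc mult.left_commute exp_two_pi_i add_divide_distrib)
qed

text \<open>Now \<open>z\<close> dominates, so \<open>cis x * z\<close> is factored out and
  \<open>q = w / z\<close>. The logarithmic primitive \<open>P\<close> has no linear part and takes
  equal values at both ends.\<close>

lemma integral_circle_inverse_outside: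
  fixes w z :: complex
  assumes "cmod w < cmod z"
  shows "((\<lambda>\<theta>. 1 / (w - cis \<theta> * z)) has_integral 0) {0..2*pi}"
proof -
  define q where "q = w / z"
  have z: "z \<noteq> 0" using assms by auto
  have q: "cmod q < 1" unfolding q_def using assms z by (simp add: norm_divide)
  define E where "E = (\<lambda>x::complex. exp (- (\<i> * x)))"
  have E0: "cmod (E (of_real x)) = 1" for x :: real by (simp add: E_def norm_exp_eq_Re)
  have re: "1 - q * E (of_real x) \<notin> \<real>\<^sub>\<le>\<^sub>0" for x :: real
  proof -
    have "cmod (q * E (of_real x)) < 1" using q E0 by (simp add: norm_mult)
    then have "Re (q * E (of_real x)) < 1" using complex_Re_le_cmod[of "q * E (of_real x)"] by linarith
    then show ?thesis by (simp add: complex_nonpos_Reals_iff)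
  qed
  have dE [derivative_intros]: "(E has_field_derivative - \<i> * E x) (at x)" for x
    unfolding E_def by (auto intro!: derivative_eq_intros)
  \<comment> \<open>For \<open>w = 0\<close> the logarithmic formula would be divided by 0; its
    limit \<open>- \<i> * E x / z\<close> replaces it.\<close>
  define P where "P = (\<lambda>x. if w = 0 then - \<i> * E x / z else \<i> * Ln (1 - q * E x) / w)"
  have "((\<lambda>x. 1 / (w - cis x * z)) has_integral (P (of_real (2*pi)) - P (of_real 0))) {0..2*pi}"
  proof (rule fundamental_theorem_of_calculus)
    fix x :: real assume "x \<in> {0..2*pi}"
    have nz: "1 - q * E (of_real x) \<noteq> 0" using re[of x] by auto
    have eq: "w - cis x * z = - (z / E (of_real x)) * (1 - q * E (of_real x))"
      using z by (simp add: q_def E_def cis_conv_exp field_simps exp_minus)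
    have Enz: "E (of_real x) \<noteq> 0" by (simp add: E_def)
    have "(P has_field_derivative 1 / (w - cis x * z)) (at (of_real x))"
    proof (cases "w = 0")
      case True
      have "((\<lambda>x. - \<i> * E x / z) has_field_derivative - \<i> * (- \<i> * E (of_real x)) / z) (at (of_real x))"
        using z by (intro DERIV_cdivide DERIV_cmult dE)
      moreover have "- \<i> * (- \<i> * E (of_real x)) / z = 1 / (w - cis x * z)"
        proof -
        have "- \<i> * (- \<i> * E (of_real x)) = - E (of_real x)" by (simp add: complex_eq_iff)
        then show ?thesis using True z Enz unfolding eq by (simp add: q_def)
      qed
      ultimately show ?thesis using True by (simp add: P_def)
    next
      case False
      have "((\<lambda>x. \<i> * Ln (1 - q * E x) / w) has_field_derivative \<i> * (- (q * (- \<i> * E (of_real x))) / (1 - q * E (of_real x))) / w) (at (of_real x))"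
      proof (intro DERIV_cdivide DERIV_cmult)
        have "((\<lambda>x. 1 - q * E x) has_field_derivative - (q * (- \<i> * E (of_real x)))) (at (of_real x))"
          by (auto intro!: derivative_eq_intros)
        then have "((\<lambda>x. Ln (1 - q * E x)) has_field_derivative inverse (1 - q * E (of_real x)) * - (q * (- \<i> * E (of_real x)))) (at (of_real x))"
          using re[of x] by (intro DERIV_chain2[where f = Ln] has_field_derivative_Ln)
        then show "((\<lambda>x. Ln (1 - q * E x)) has_field_derivative - (q * (- \<i> * E (of_real x))) / (1 - q * E (of_real x))) (at (of_real x))"
          by (simp add: divide_inverse mult.commute)
      qed
      moreover have "\<i> * (- (q * (- \<i> * E (of_real x))) / (1 - q * E (of_real x))) / w = 1 / (w - cis x * z)"
        unfolding eq using nz z Enz False by (simp add: q_def)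
      ultimately show ?thesis using False by (simp add: P_def)
    qed
    from has_vector_derivative_real_field[OF this]
    show "((\<lambda>x. P (of_real x)) has_vector_derivative 1 / (w - cis x * z)) (at x within {0..2*pi})" .
  qed simp
  moreover have "E (of_real (2*pi)) = E (of_real 0)"
    using exp_two_pi_i' by (simp add: E_def exp_minus mult.commute mult.assoc mult.left_commute exp_two_pi_i)
  then have "P (of_real (2*pi)) = P (of_real 0)" unfolding P_def by simp
  ultimately show ?thesis by simp
qed

text \<open>Averaging the integrand over all rotations turns it into \<open>1 / w\<close> for \<open>|z| < |w|\<close> and \<open>0\<close> for \<open>|z| > |w|\<close>.\<close>

lemma integral_inverse_cball_0:
  fixes w :: complex
  assumes r: "0 < r"
  shows "(\<integral>z. indicator (cball 0 r) z *\<^sub>R (1 / (w - z)) \<partial>lborel) = pi * (min (cmod w) r)\<^sup>2 / w"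
    (is "?I = _")
proof -
  define F where "F = (\<lambda>(\<theta>::real) (z::complex). indicator {0..2*pi} \<theta> *\<^sub>R (indicator (cball 0 r) z *\<^sub>R (1 / (w - cis \<theta> * z))))"
  \<comment> \<open>The disk about 0 and the measure are both invariant under rotation, so every
    angle gives the same integral.\<close>
  have rot: "(\<integral>z. indicator (cball 0 r) z *\<^sub>R (1 / (w - cis \<theta> * z)) \<partial>lborel) = ?I" for \<theta>
  proof -
    have "?I = (\<integral>z. indicator (cball 0 r) z *\<^sub>R (1 / (w - z)) \<partial>distr lborel borel ((*) (cis \<theta>)))"
      by (simp add: distr_lborel_mult_unit_complex)
    also have "\<dots> = (\<integral>z. indicator (cball 0 r) (cis \<theta> * z) *\<^sub>R (1 / (w - cis \<theta> * z)) \<partial>lborel)"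
      by (subst integral_distr) auto
    also have "\<dots> = (\<integral>z. indicator (cball 0 r) z *\<^sub>R (1 / (w - cis \<theta> * z)) \<partial>lborel)"
      by (intro Bochner_Integration.integral_cong) (auto simp: indicator_def norm_mult)
    finally show ?thesis ..
  qed
  have nrot: "(\<integral>\<^sup>+z. ennreal (norm (F \<theta> z)) \<partial>lborel) \<le> ennreal (pi * r\<^sup>2 + 2 * pi) * indicator {0..2*pi} \<theta>" for \<theta>
  proof -
    have "(\<integral>\<^sup>+z. ennreal (norm (F \<theta> z)) \<partial>lborel) = (\<integral>\<^sup>+z. indicator {0..2*pi} \<theta> * (ennreal (1 / cmod (w - cis \<theta> * z)) * indicator (cball 0 r) (cis \<theta> * z)) \<partial>lborel)"
      by (intro nn_integral_cong) (auto simp: F_def indicator_def norm_divide norm_mult)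
    also have "\<dots> = indicator {0..2*pi} \<theta> * (\<integral>\<^sup>+z. (ennreal (1 / cmod (w - cis \<theta> * z)) * indicator (cball 0 r) (cis \<theta> * z)) \<partial>lborel)"
      by (subst nn_integral_cmult) auto
    also have "(\<integral>\<^sup>+z. (ennreal (1 / cmod (w - cis \<theta> * z)) * indicator (cball 0 r) (cis \<theta> * z)) \<partial>lborel)
      = (\<integral>\<^sup>+z. ennreal (1 / cmod (w - z)) * indicator (cball 0 r) z \<partial>distr lborel borel ((*) (cis \<theta>)))"
      by (subst nn_integral_distr) auto
    also have "distr lborel borel ((*) (cis \<theta>)) = lborel"
      by (rule distr_lborel_mult_unit_complex) simp
    finally show ?thesis
      using nn_integral_inverse_norm_cball[of r w 0] r by (simp add: mult.commute mult_left_mono)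
  qed
  have mF: "case_prod F \<in> borel_measurable (lborel \<Otimes>\<^sub>M lborel)"
    unfolding F_def cis_conv_exp by measurable
  have iF: "integrable (lborel \<Otimes>\<^sub>M lborel) (case_prod F)"
  proof (rule integrableI_bounded[OF mF])
    have "(\<integral>\<^sup>+x. ennreal (norm (case x of (x, y) \<Rightarrow> F x y)) \<partial>(lborel \<Otimes>\<^sub>M lborel)) = (\<integral>\<^sup>+\<theta>. \<integral>\<^sup>+z. ennreal (norm (F \<theta> z)) \<partial>lborel \<partial>lborel)"
      using mF by (subst lborel.nn_integral_fst[symmetric]) (auto simp: split_beta)
    also have "\<dots> \<le> (\<integral>\<^sup>+\<theta>. ennreal (pi * r\<^sup>2 + 2 * pi) * indicator {0..2*pi} \<theta> \<partial>lborel)"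
      by (intro nn_integral_mono nrot)
    also have "\<dots> < \<infinity>" by (simp add: nn_integral_cmult ennreal_mult_less_top)
    finally show "(\<integral>\<^sup>+x. ennreal (norm (case x of (x, y) \<Rightarrow> F x y)) \<partial>(lborel \<Otimes>\<^sub>M lborel)) < \<infinity>" .
  qed
  have "(\<integral>\<theta>. (\<integral>z. F \<theta> z \<partial>lborel) \<partial>lborel) = (\<integral>\<theta>. indicator {0..2*pi} \<theta> *\<^sub>R ?I \<partial>lborel)"
    unfolding F_def integral_scaleR_right rot ..
  also have "\<dots> = 2 * pi * ?I"
    by (simp add: scaleR_conv_of_real)
  finally have 1: "(\<integral>z. (\<integral>\<theta>. F \<theta> z \<partial>lborel) \<partial>lborel) = 2 * pi * ?I"
    using lborel_pair.Fubini_integral[OF iF] by simp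
  have "(\<integral>z. (\<integral>\<theta>. F \<theta> z \<partial>lborel) \<partial>lborel) = (\<integral>z. indicator (cball (0::complex) (min (cmod w) r)) z *\<^sub>R (2 * pi / w) \<partial>lborel)"
  proof (rule Bochner_Integration.integral_cong_AE)
    show "(\<lambda>z. \<integral>\<theta>. F \<theta> z \<partial>lborel) \<in> borel_measurable lborel"
      using lborel_pair.integrable_snd[OF iF] by (rule borel_measurable_integrable)
    \<comment> \<open>On the circle \<open>cmod z = cmod w\<close> some rotation carries
      \<open>z\<close> to \<open>w\<close> and neither circle average applies; this circle is
      null.\<close>
    have "AE z in lborel. z \<notin> sphere (0::complex) (cmod w)"
    proof (rule AE_not_in)
      show "sphere (0::complex) (cmod w) \<in> null_sets lborel"
        using negligible_sphere[of "0::complex" "cmod w"]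
        by (subst null_sets_completion_iff[symmetric]) (auto simp: negligible_iff_null_sets borel_closed)
    qed
    then show "AE z in lborel. (\<integral>\<theta>. F \<theta> z \<partial>lborel) = indicator (cball (0::complex) (min (cmod w) r)) z *\<^sub>R (2 * pi / w)"
    proof eventually_elim
      case (elim z)
      let ?f = "\<lambda>\<theta>. 1 / (w - cis \<theta> * z)"
      define J where "J = (if cmod z < cmod w then 2 * pi / w else 0)"
      have hi: "(?f has_integral J) {0..2*pi}"
        using elim integral_circle_inverse_inside[of z w] integral_circle_inverse_outside[of w z]
        by (auto simp: J_def not_less)
      have "w - cis \<theta> * z \<noteq> 0" for \<theta>
      proof
        assume "w - cis \<theta> * z = 0"
        then have "cmod w = cmod (cis \<theta> * z)" by simp
        then show False using elim by (simp add: norm_mult)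
      qed
      then have cont: "continuous_on {0..2*pi} ?f"
        by (auto intro!: continuous_intros)
      have si: "set_integrable lborel {0..2*pi} ?f"
        using cont unfolding set_integrable_def by (intro borel_integrable_compact) auto
      have "(\<integral>\<theta>. F \<theta> z \<partial>lborel) = (\<integral>\<theta>. indicator (cball 0 r) z *\<^sub>R (indicator {0..2*pi} \<theta> *\<^sub>R ?f \<theta>) \<partial>lborel)"
        by (simp add: F_def mult.commute)
      also have "\<dots> = indicator (cball 0 r) z *\<^sub>R (\<integral>\<theta>. indicator {0..2*pi} \<theta> *\<^sub>R ?f \<theta> \<partial>lborel)"
        by (rule integral_scaleR_right)
      also have "(\<integral>\<theta>. indicator {0..2*pi} \<theta> *\<^sub>R ?f \<theta> \<partial>lborel) = J"
        using set_borel_integral_eq_integral(2)[OF si] integral_unique[OF hi] by (simp add: set_lebesgue_integral_def)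
      finally show ?case using elim by (auto simp: J_def indicator_def)
    qed
  qed auto
  also have "\<dots> = (pi * (min (cmod w) r)\<^sup>2) *\<^sub>R (2 * pi / w)"
    using r by (simp add: measure_def emeasure_cball eval_unit_ball_vol)
  finally have "2 * pi * ?I = 2 * pi * (pi * (min (cmod w) r)\<^sup>2 / w)"
    using 1 by (simp add: scaleR_conv_of_real mult_ac)
  then show ?thesis
    by (subst (asm) mult_cancel_left) simp
qed

lemma integral_inverse_cball:
  fixes w c :: complex
  assumes r: "0 < r"
  shows "(\<integral>z. indicator (cball c r) z *\<^sub>R (1 / (w - z)) \<partial>lborel) = pi * (min (cmod (w - c)) r)\<^sup>2 / (w - c)"
proof -
  have "(\<integral>z. indicator (cball c r) z *\<^sub>R (1 / (w - z)) \<partial>lborel) = (\<integral>z. indicator (cball c r) z *\<^sub>R (1 / (w - z)) \<partial>distr lborel borel ((+) c))"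
    by (simp add: lborel_distr_plus)
  also have "\<dots> = (\<integral>z. indicator (cball c r) (c + z) *\<^sub>R (1 / (w - (c + z))) \<partial>lborel)"
    by (subst integral_distr) auto
  also have "\<dots> = (\<integral>z. indicator (cball 0 r) z *\<^sub>R (1 / ((w - c) - z)) \<partial>lborel)"
    by (intro Bochner_Integration.integral_cong) (auto simp: indicator_def dist_norm algebra_simps)
  finally show ?thesis using integral_inverse_cball_0[OF r, of "w - c"] by simp
qed

section \<open>The area as a curve integral\<close>

text \<open>Extending over the real line allows arbitrary shifts of the parameter and two-sided
  derivatives everywhere. Simple closedness becomes injectivity for parameters less than one period
  apart.\<close>

locale periodic_unit_speed =
  fixes L :: real and \<gamma> T :: "real \<Rightarrow> complex"
  assumes L_pos: "0 < L"
    and deriv: "\<And>s. (\<gamma> has_vector_derivative T s) (at s)"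
    and cont_T: "continuous_on UNIV T"
    and norm_T: "\<And>s. cmod (T s) = 1"
    and per: "\<And>s. \<gamma> (s + L) = \<gamma> s"
    and per_T: "\<And>s. T (s + L) = T s"
    and inj: "\<And>s t. \<gamma> s = \<gamma> t \<Longrightarrow> \<bar>s - t\<bar> < L \<Longrightarrow> s = t"
begin

lemma cont: "continuous_on A \<gamma>"
  using deriv by (meson continuous_at_imp_continuous_on has_vector_derivative_continuous)

lemma cont_T_on: "continuous_on A T"
  using cont_T continuous_on_subset by blast

end

lemma has_vector_derivative_within_Un:
  assumes "(f has_vector_derivative d) (at x within A)" "(f has_vector_derivative d) (at x within B)"
  shows "(f has_vector_derivative d) (at x within A \<union> B)"
  using assms unfolding has_vector_derivative_def has_derivative_within
  by (auto simp: at_within_union filterlim_sup)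

text \<open>The translates of the curve fit together because values and velocities agree at the base
  point; at a multiple of \<open>L\<close> the derivative is glued from the two adjacent
  periods.\<close>

lemma periodic_extension:
  assumes loop: "C1_arclength_loop L \<gamma>0"
    and sp: "simple_path (unit_rescale L \<gamma>0)"
  obtains \<gamma> T where "periodic_unit_speed L \<gamma> T" "\<And>s. s \<in> {0..L} \<Longrightarrow> \<gamma> s = \<gamma>0 s"
proof -
  from loop obtain T0 where L: "0 < L" and end0: "\<gamma>0 0 = \<gamma>0 L"
    and cT0: "continuous_on {0..L} T0" and T0: "T0 0 = T0 L"
    and d0: "\<And>s. s \<in> {0..L} \<Longrightarrow> (\<gamma>0 has_vector_derivative T0 s) (at s within {0..L})"
    and n0: "\<And>s. s \<in> {0..L} \<Longrightarrow> norm (T0 s) = 1"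
    unfolding C1_arclength_loop_def by blast
  define m where "m s = s - L * of_int \<lfloor>s / L\<rfloor>" for s
  have m: "0 \<le> m s" "m s < L" for s
    using floor_divide_lower[OF L, of s] floor_divide_upper[OF L, of s] by (auto simp: m_def algebra_simps)
  define \<gamma> where "\<gamma> s = \<gamma>0 (m s)" for s
  define T where "T s = T0 (m s)" for s
  define I where "I n = {L * of_int n..L * of_int n + L}" for n :: int
  \<comment> \<open>At the right end of a period \<open>m\<close> jumps back to 0 whereas the
    shifted parameter is \<open>L\<close>; the matching conditions \<open>end0\<close> and
    \<open>T0\<close> make both readings agree.\<close>
  have mI: "m s = s - L * of_int n \<or> (m s = 0 \<and> s - L * of_int n = L)" if "s \<in> I n" for s n
  proof (cases "s = L * of_int n + L")
    case True
    then have "s / L = of_int (n + 1)" using L by (simp add: field_simps)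
    then have "\<lfloor>s / L\<rfloor> = n + 1" by (simp only: floor_of_int)
    then show ?thesis using True by (simp add: m_def algebra_simps)
  next
    case False
    then have "\<lfloor>s / L\<rfloor> = n" using that L by (auto simp: I_def floor_eq_iff field_simps)
    then show ?thesis by (simp add: m_def)
  qed
  have gI: "\<gamma> s = \<gamma>0 (s - L * of_int n)" if "s \<in> I n" for s n
    using mI[OF that] end0 by (auto simp: \<gamma>_def)
  have TI: "T s = T0 (s - L * of_int n)" if "s \<in> I n" for s n
    using mI[OF that] T0 by (auto simp: T_def)
  have dI: "(\<gamma> has_vector_derivative T s) (at s within I n)" if "s \<in> I n" for s n
  proof -
    have "(\<gamma>0 has_vector_derivative T0 (s - L * of_int n)) (at (s - L * of_int n) within (\<lambda>s. s - L * of_int n) ` I n)"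
      by (rule has_vector_derivative_within_subset[OF d0]) (use that in \<open>auto simp: I_def\<close>)
    then have "((\<gamma>0 \<circ> (\<lambda>s. s - L * of_int n)) has_vector_derivative 1 *\<^sub>R T0 (s - L * of_int n)) (at s within I n)"
      by (rule vector_diff_chain_within[rotated]) (auto intro!: derivative_eq_intros)
    then have "((\<gamma>0 \<circ> (\<lambda>s. s - L * of_int n)) has_vector_derivative T s) (at s within I n)"
      by (simp add: TI[OF that])
    then show ?thesis
      by (rule has_vector_derivative_transform[rotated 2]) (use that gI in auto)
  qed
  have cI: "continuous_on (I n) T" for n
  proof -
    have "continuous_on (I n) (\<lambda>s. T0 (s - L * of_int n))"
      by (rule continuous_on_compose2[OF cT0]) (auto simp: I_def intro!: continuous_intros)
    then show ?thesis using TI by (simp cong: continuous_on_cong)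
  qed
  \<comment> \<open>The period starting at \<open>L * of_int n\<close> and the preceding one
    together form a neighbourhood of \<open>s\<close>; the preceding one contains \<open>s\<close>
    only at the common endpoint.\<close>
  have nbhd: "s \<in> interior (I n \<union> I (n - 1))" "s \<in> I n" "s = L * of_int n \<Longrightarrow> s \<in> I (n - 1)"
    if "n = \<lfloor>s / L\<rfloor>" for s n
  proof -
    have h: "L * of_int n \<le> s" "s < L * of_int n + L"
      using m[of s] by (auto simp: m_def that)
    have "{L * of_int n - L<..<L * of_int n + L} \<subseteq> I n \<union> I (n - 1)"
      by (auto simp: I_def algebra_simps)
    then have "{L * of_int n - L<..<L * of_int n + L} \<subseteq> interior (I n \<union> I (n - 1))"
      by (simp add: interior_maximal)
    then show "s \<in> interior (I n \<union> I (n - 1))" using h L by auto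
    show "s \<in> I n" using h by (simp add: I_def)
    show "s \<in> I (n - 1)" if "s = L * of_int n" using L that by (simp add: I_def algebra_simps)
  qed
  have dU: "(\<gamma> has_vector_derivative T s) (at s)" for s
  proof -
    define n where "n = \<lfloor>s / L\<rfloor>"
    have "(\<gamma> has_vector_derivative T s) (at s within I n \<union> I (n - 1))"
    proof (rule has_vector_derivative_within_Un)
      show "(\<gamma> has_vector_derivative T s) (at s within I n)" using nbhd(2)[OF n_def] by (rule dI)
      show "(\<gamma> has_vector_derivative T s) (at s within I (n - 1))"
      proof (cases "s = L * of_int n")
        case True then show ?thesis using dI nbhd(3)[OF n_def] by blast
      next
        case False
        then have "s \<notin> I (n - 1)" using nbhd(2)[OF n_def] by (auto simp: I_def algebra_simps)
        moreover have "closed (I (n - 1))" by (simp add: I_def)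
        ultimately have "at s within I (n - 1) = bot"
          using trivial_limit_within[of s "I (n - 1)"] by (auto simp: closed_limpt)
        then show ?thesis
          unfolding has_vector_derivative_def has_derivative_within
          by (simp add: bounded_linear_scaleR_left)
      qed
    qed
    then show ?thesis unfolding at_within_interior[OF nbhd(1)[OF n_def]] .
  qed
  have cU: "continuous_on UNIV T"
  proof -
    have "isCont T s" for s
    proof -
      define n where "n = \<lfloor>s / L\<rfloor>"
      have "continuous_on (I n \<union> I (n - 1)) T"
        by (intro continuous_on_closed_Un cI) (simp_all add: I_def)
      then show ?thesis using nbhd(1)[OF n_def]
        by (simp add: continuous_on_interior)
    qed
    then show ?thesis by (simp add: continuous_at_imp_continuous_on)
  qed
  have mper: "m (s + L) = m s" for s
  proof -
    have "\<lfloor>(s + L) / L\<rfloor> = \<lfloor>s / L\<rfloor> + 1" using L by (simp add: add_divide_distrib)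
    then show ?thesis by (simp add: m_def algebra_simps)
  qed
  have inj0: "a = b" if "\<gamma>0 a = \<gamma>0 b" "0 \<le> a" "a < L" "0 \<le> b" "b < L" for a b
  proof -
    have "unit_rescale L \<gamma>0 (a / L) = unit_rescale L \<gamma>0 (b / L)"
      using that L by (simp add: unit_rescale_def)
    then have "a / L = b / L"
      using sp that L unfolding simple_path_def loop_free_def
      by (smt (verit) atLeastAtMost_iff divide_less_eq_1_pos divide_nonneg_pos)
    then show ?thesis using L by simp
  qed
  have inj: "s = t" if "\<gamma> s = \<gamma> t" "\<bar>s - t\<bar> < L" for s t
  proof -
    have "m s = m t" using that m by (intro inj0) (auto simp: \<gamma>_def)
    then have e: "s - t = L * (of_int \<lfloor>s / L\<rfloor> - of_int \<lfloor>t / L\<rfloor>)" by (simp add: m_def algebra_simps)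
    then have "\<bar>L * of_int (\<lfloor>s / L\<rfloor> - \<lfloor>t / L\<rfloor>)\<bar> < L * 1" using that by simp
    then have "\<bar>of_int (\<lfloor>s / L\<rfloor> - \<lfloor>t / L\<rfloor>) :: real\<bar> < 1" using L by (simp add: abs_mult)
    then have "\<lfloor>s / L\<rfloor> = \<lfloor>t / L\<rfloor>" by linarith
    with e show ?thesis by simp
  qed
  have agree: "\<gamma> s = \<gamma>0 s" if "s \<in> {0..L}" for s
    using gI[of s 0] that by (simp add: I_def)
  have "periodic_unit_speed L \<gamma> T"
  proof
    show "cmod (T s) = 1" for s using n0[of "m s"] m[of s] by (simp add: T_def)
  qed (use L dU cU inj mper in \<open>auto simp: T_def \<gamma>_def\<close>)
  then show thesis using agree that by blast
qed

section \<open>Winding numbers and Fubini's theorem\<close>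

text \<open>\<open>\<pi>\<close> times \<open>kernel r\<close> is the Cauchy transform of the disk of radius \<open>r\<close> about \<open>0\<close>; at \<open>w = 0\<close> division
  gives its actual value \<open>0\<close>.\<close>

definition kernel :: "real \<Rightarrow> complex \<Rightarrow> complex" where
  "kernel r w = of_real ((min (cmod w) r)\<^sup>2) / w"

context periodic_unit_speed
begin

lemma winding_number_unit_rescale:
  assumes z: "z \<notin> range \<gamma>"
  shows "((\<lambda>t. T t / (\<gamma> t - z)) has_integral 2 * pi * \<i> * winding_number (unit_rescale L \<gamma>) z) {0..L}"
proof -
  let ?p = "unit_rescale L \<gamma>"
  have dp: "(?p has_vector_derivative L *\<^sub>R T (L * x)) (at x within S)" for x S
  proof -
    have "((\<gamma> \<circ> (\<lambda>x. L * x)) has_vector_derivative L *\<^sub>R T (L * x)) (at x within S)"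
      by (rule vector_diff_chain_within)
         (auto intro!: derivative_eq_intros has_vector_derivative_at_within[OF deriv])
    then show ?thesis by (simp add: unit_rescale_def o_def)
  qed
  have "?p C1_differentiable_on {0..1}"
    unfolding C1_differentiable_on_def
    using dp by (intro exI[of _ "\<lambda>x. L *\<^sub>R T (L * x)"])
      (auto intro!: continuous_intros continuous_on_compose2[OF cont_T])
  then have vp: "valid_path ?p"
    by (simp add: valid_path_def C1_differentiable_imp_piecewise)
  have zp: "z \<notin> path_image ?p" using z by (auto simp: path_image_def unit_rescale_def)
  have "((\<lambda>w. 1 / (w - z)) has_contour_integral 2 * pi * \<i> * winding_number ?p z) ?p"
    using has_contour_integral_winding_number[OF vp zp] by simp
  then have h1: "((\<lambda>x. 1 / (?p x - z) * vector_derivative ?p (at x within {0..1})) has_integral 2 * pi * \<i> * winding_number ?p z) {0..1}"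
    by (simp add: has_contour_integral_def)
  have h1: "((\<lambda>x. L *\<^sub>R (T (L * x) / (\<gamma> (L * x) - z))) has_integral 2 * pi * \<i> * winding_number ?p z) {0..1}"
    using h1
  proof (rule has_integral_eq[rotated])
    fix x :: real assume "x \<in> {0..1}"
    then have "vector_derivative ?p (at x within {0..1}) = L *\<^sub>R T (L * x)"
      using dp by (intro vector_derivative_within_closed_interval) auto
    then show "1 / (?p x - z) * vector_derivative ?p (at x within {0..1}) = L *\<^sub>R (T (L * x) / (\<gamma> (L * x) - z))"
      by (simp add: unit_rescale_def)
  qed
  have "((\<lambda>x. (\<lambda>x. L *\<^sub>R (T (L * x) / (\<gamma> (L * x) - z))) ((1 / L) * x)) has_integral (1 / \<bar>1 / L\<bar>) *\<^sub>R (2 * pi * \<i> * winding_number ?p z)) ((\<lambda>x. x / (1 / L)) ` {0..1})"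
    by (rule has_integral_stretch_real[OF h1]) (use L_pos in auto)
  moreover have "(\<lambda>x. x / (1 / L)) ` {0..1} = {0..L}"
    using L_pos by (auto simp: image_def field_simps intro!: bexI[of _ "_ / L"])
  ultimately have "((\<lambda>x. L *\<^sub>R (T x / (\<gamma> x - z))) has_integral L *\<^sub>R (2 * pi * \<i> * winding_number ?p z)) {0..L}"
    using L_pos by simp
  from has_integral_cmul[OF this, of "1 / L"] show ?thesis using L_pos by simp
qed

lemma per_int: "\<gamma> (s + of_int n * L) = \<gamma> s"
proof (induction n rule: int_induct[of _ 0])
  case (step1 i)
  then show ?case using per[of "s + of_int i * L"] by (simp add: algebra_simps)
next
  case (step2 i)
  then show ?case using per[of "s + of_int (i - 1) * L"] by (simp add: algebra_simps)
qed simp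

lemma range_eq_path_image: "range \<gamma> = path_image (unit_rescale L \<gamma>)"
proof
  show "range \<gamma> \<subseteq> path_image (unit_rescale L \<gamma>)"
  proof safe
    fix s
    define x where "x = (s - of_int \<lfloor>s / L\<rfloor> * L) / L"
    have "x \<in> {0..1}"
      using floor_divide_lower[OF L_pos, of s] floor_divide_upper[OF L_pos, of s] L_pos
      by (auto simp: x_def field_simps)
    moreover have "\<gamma> s = unit_rescale L \<gamma> x"
      using per_int[of s "- \<lfloor>s / L\<rfloor>"] L_pos by (simp add: x_def unit_rescale_def)
    ultimately show "\<gamma> s \<in> path_image (unit_rescale L \<gamma>)" by (auto simp: path_image_def)
  qed
qed (auto simp: path_image_def unit_rescale_def)

lemma negligible_range: "negligible (range \<gamma>)"
proof (rule negligible_differentiable_image_lowdim)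
  show "\<gamma> differentiable_on UNIV"
    using deriv by (meson differentiable_at_imp_differentiable_on differentiableI_vector)
qed simp


text \<open>Only points outside \<open>\<Omega>\<close> need an argument. Each Jordan component
  avoids the frontier, hence lies in \<open>\<Omega>\<close> or misses it. The unbounded one cannot
  lie in a compact set; if the bounded one missed \<open>\<Omega>\<close> as well,
  \<open>\<Omega>\<close> would be contained in its frontier and have empty interior. So a point off
  \<open>\<Omega>\<close> is in the unbounded component, where the winding number is 0.\<close>

lemma winding_number_eq_indicator:
  assumes ccw: "ccw_arclength_boundary \<Omega> L \<gamma>" and z: "z \<notin> range \<gamma>"
  shows "winding_number (unit_rescale L \<gamma>) z = indicator \<Omega> z"
proof -
  let ?p = "unit_rescale L \<gamma>"
  have cp: "compact \<Omega>" and ine: "interior \<Omega> \<noteq> {}" and sp: "simple_path ?p"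
    and pim: "path_image ?p = frontier \<Omega>" and wn: "\<And>z. z \<in> interior \<Omega> \<Longrightarrow> winding_number ?p z = 1"
    using ccw by (auto simp: ccw_arclength_boundary_def)
  have closed_p: "pathfinish ?p = pathstart ?p"
    using per[of 0] by (simp add: pathfinish_def pathstart_def unit_rescale_def)
  have zf: "z \<notin> frontier \<Omega>" using z pim range_eq_path_image by simp
  show ?thesis
  proof (cases "z \<in> \<Omega>")
    case True
    then have "z \<in> interior \<Omega>" using zf closure_subset by (auto simp: frontier_def)
    then show ?thesis using wn True by simp
  next
    case False
    have J: "open (inside (path_image ?p))" "connected (inside (path_image ?p))" "connected (outside (path_image ?p))"
        "\<not> bounded (outside (path_image ?p))" "inside (path_image ?p) \<inter> outside (path_image ?p) = {}"
        "inside (path_image ?p) \<union> outside (path_image ?p) = - path_image ?p"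
      using Jordan_inside_outside[OF sp closed_p] by auto
    have dich: "S \<inter> \<Omega> = {} \<or> S \<subseteq> \<Omega>" if "connected S" "S \<inter> frontier \<Omega> = {}" for S
      using connected_Int_frontier[OF that(1), of \<Omega>] that(2) by blast
    have od: "outside (path_image ?p) \<inter> frontier \<Omega> = {}" "inside (path_image ?p) \<inter> frontier \<Omega> = {}"
      using J(6) pim by auto
    have o: "outside (path_image ?p) \<inter> \<Omega> = {}"
      using dich[OF J(3) od(1)] J(4) compact_imp_bounded[OF cp] bounded_subset by blast
    have "inside (path_image ?p) \<subseteq> \<Omega>"
    proof (rule ccontr)
      assume "\<not> inside (path_image ?p) \<subseteq> \<Omega>"
      then have "inside (path_image ?p) \<inter> \<Omega> = {}" using dich[OF J(2) od(2)] by blast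
      with o J(6) have "\<Omega> \<subseteq> frontier \<Omega>" using pim by blast
      then show False using ine interior_subset[of \<Omega>] by (auto simp: frontier_def)
    qed
    then have "z \<in> outside (path_image ?p)" using False J(6) zf pim by blast
    then have "winding_number ?p z = 0"
      using sp closed_p by (intro winding_number_zero_in_outside simple_path_imp_path)
    then show ?thesis using False by simp
  qed
qed

text \<open>\<open>F\<close> is integrated in both orders: over the disk first it yields the Cauchy
  transform \<open>pi * kernel r\<close>, over the curve first the winding number, which is the
  indicator of \<open>\<Omega>\<close> off the null set \<open>range \<gamma>\<close>.\<close>

lemma area_formula:
  assumes ccw: "ccw_arclength_boundary \<Omega> L \<gamma>" and r: "0 < r"
  shows "of_real (measure lebesgue (\<Omega> \<inter> cball c r)) = (\<integral>t. indicator {0..L} t *\<^sub>R (kernel r (\<gamma> t - c) * T t) \<partial>lborel) / (2 * \<i>)"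
proof -
  define F where "F = (\<lambda>t z. indicator {0..L} t *\<^sub>R (indicator (cball c r) z *\<^sub>R (T t / (\<gamma> t - z))))"
  have [measurable]: "\<gamma> \<in> borel_measurable borel" "T \<in> borel_measurable borel"
    using cont[of UNIV] cont_T by (auto intro: borel_measurable_continuous_onI)
  have cp: "compact \<Omega>" using ccw by (simp add: ccw_arclength_boundary_def)
  have mF: "case_prod F \<in> borel_measurable (lborel \<Otimes>\<^sub>M lborel)"
    unfolding F_def by measurable
  \<comment> \<open>A bound uniform in \<open>t\<close> makes \<open>F\<close> integrable over the
    product although it is singular along the curve.\<close>
  have nF: "(\<integral>\<^sup>+z. ennreal (norm (F t z)) \<partial>lborel) \<le> ennreal (pi * r\<^sup>2 + 2 * pi) * indicator {0..L} t" for t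
  proof -
    have "(\<integral>\<^sup>+z. ennreal (norm (F t z)) \<partial>lborel) = (\<integral>\<^sup>+z. indicator {0..L} t * (ennreal (1 / cmod (\<gamma> t - z)) * indicator (cball c r) z) \<partial>lborel)"
      by (intro nn_integral_cong) (auto simp: F_def indicator_def norm_divide norm_T)
    also have "\<dots> = indicator {0..L} t * (\<integral>\<^sup>+z. (ennreal (1 / cmod (\<gamma> t - z)) * indicator (cball c r) z) \<partial>lborel)"
      by (subst nn_integral_cmult) auto
    finally show ?thesis
      using nn_integral_inverse_norm_cball[of r "\<gamma> t" c] r by (simp add: mult.commute mult_left_mono)
  qed
  have iF: "integrable (lborel \<Otimes>\<^sub>M lborel) (case_prod F)"
  proof (rule integrableI_bounded[OF mF])
    have "(\<integral>\<^sup>+x. ennreal (norm (case x of (x, y) \<Rightarrow> F x y)) \<partial>(lborel \<Otimes>\<^sub>M lborel)) = (\<integral>\<^sup>+t. \<integral>\<^sup>+z. ennreal (norm (F t z)) \<partial>lborel \<partial>lborel)"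
      using mF by (subst lborel.nn_integral_fst[symmetric]) (auto simp: split_beta)
    also have "\<dots> \<le> (\<integral>\<^sup>+t. ennreal (pi * r\<^sup>2 + 2 * pi) * indicator {0..L} t \<partial>lborel)"
      by (intro nn_integral_mono nF)
    also have "\<dots> < \<infinity>" using L_pos by (simp add: nn_integral_cmult ennreal_mult_less_top)
    finally show "(\<integral>\<^sup>+x. ennreal (norm (case x of (x, y) \<Rightarrow> F x y)) \<partial>(lborel \<Otimes>\<^sub>M lborel)) < \<infinity>" .
  qed
  have in1: "(\<integral>z. F t z \<partial>lborel) = pi * (indicator {0..L} t *\<^sub>R (kernel r (\<gamma> t - c) * T t))" for t
  proof -
    have "(\<integral>z. F t z \<partial>lborel) = (\<integral>z. (indicator {0..L} t * T t) * (indicator (cball c r) z *\<^sub>R (1 / (\<gamma> t - z))) \<partial>lborel)"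
      by (intro Bochner_Integration.integral_cong) (auto simp: F_def indicator_def)
    also have "\<dots> = (indicator {0..L} t * T t) * (\<integral>z. (indicator (cball c r) z *\<^sub>R (1 / (\<gamma> t - z))) \<partial>lborel)"
      by (rule integral_mult_right_zero)
    finally show ?thesis
      unfolding integral_inverse_cball[OF r] kernel_def by (cases "t \<in> {0..L}") simp_all
  qed
  have "(\<integral>z. (\<integral>t. F t z \<partial>lborel) \<partial>lborel) = (\<integral>z. indicator (\<Omega> \<inter> cball c r) z *\<^sub>R (2 * pi * \<i>) \<partial>lborel)"
  proof (rule Bochner_Integration.integral_cong_AE)
    show "(\<lambda>z. \<integral>t. F t z \<partial>lborel) \<in> borel_measurable lborel"
      using lborel_pair.integrable_snd[OF iF] by (rule borel_measurable_integrable)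
    have "range \<gamma> \<in> sets borel"
      unfolding range_eq_path_image
      using ccw by (intro borel_compact compact_path_image simple_path_imp_path) (auto simp: ccw_arclength_boundary_def)
    then have "AE z in lborel. z \<notin> range \<gamma>"
      using negligible_range
      by (intro AE_not_in) (auto simp: negligible_iff_null_sets null_sets_completion_iff)
    then show "AE z in lborel. (\<integral>t. F t z \<partial>lborel) = indicator (\<Omega> \<inter> cball c r) z *\<^sub>R (2 * pi * \<i>)"
    proof eventually_elim
      case (elim z)
      let ?f = "\<lambda>t. T t / (\<gamma> t - z)"
      have hi: "(?f has_integral 2 * pi * \<i> * indicator \<Omega> z) {0..L}"
        using winding_number_unit_rescale[OF elim] winding_number_eq_indicator[OF ccw elim] by simp
      have "continuous_on {0..L} ?f"
        using elim by (auto intro!: continuous_intros cont cont_T_on)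
      then have si: "set_integrable lborel {0..L} ?f"
        unfolding set_integrable_def by (intro borel_integrable_compact) auto
      have "(\<integral>t. F t z \<partial>lborel) = (\<integral>t. indicator (cball c r) z *\<^sub>R (indicator {0..L} t *\<^sub>R ?f t) \<partial>lborel)"
        by (simp add: F_def mult.commute)
      also have "\<dots> = indicator (cball c r) z *\<^sub>R (\<integral>t. indicator {0..L} t *\<^sub>R ?f t \<partial>lborel)"
        by (rule integral_scaleR_right)
      also have "(\<integral>t. indicator {0..L} t *\<^sub>R ?f t \<partial>lborel) = 2 * pi * \<i> * indicator \<Omega> z"
        using set_borel_integral_eq_integral(2)[OF si] integral_unique[OF hi] by (simp add: set_lebesgue_integral_def)
      finally show ?case by (auto simp: indicator_def)
    qed
  qed (use cp in \<open>auto intro!: borel_measurable_scaleR borel_measurable_indicator simp: borel_compact\<close>)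
  also have "\<dots> = measure lebesgue (\<Omega> \<inter> cball c r) *\<^sub>R (2 * pi * \<i>)"
  proof -
    have K: "compact (\<Omega> \<inter> cball c r)" using cp by (simp add: compact_Int)
    then have "integrable lborel (indicat_real (\<Omega> \<inter> cball c r))"
      using emeasure_compact_finite[OF K] by (intro integrable_real_indicator) (simp_all add: borel_compact)
    then show ?thesis
      using K by (subst integral_scaleR_left) (simp_all add: borel_compact)
  qed
  finally have "(\<integral>t. (\<integral>z. F t z \<partial>lborel) \<partial>lborel) = measure lebesgue (\<Omega> \<inter> cball c r) *\<^sub>R (2 * pi * \<i>)"
    using lborel_pair.Fubini_integral[OF iF] by simp
  then have "pi * (\<integral>t. indicator {0..L} t *\<^sub>R (kernel r (\<gamma> t - c) * T t) \<partial>lborel) = pi * (measure lebesgue (\<Omega> \<inter> cball c r) * (2 * \<i>))"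
    unfolding in1 integral_mult_right_zero by (simp add: scaleR_conv_of_real)
  then have "(\<integral>t. indicator {0..L} t *\<^sub>R (kernel r (\<gamma> t - c) * T t) \<partial>lborel) = measure lebesgue (\<Omega> \<inter> cball c r) * (2 * \<i>)"
    by (subst (asm) mult_cancel_left) simp
  then show ?thesis by (subst nonzero_eq_divide_eq) simp_all
qed

end

section \<open>Derivatives of the area\<close>

text \<open>The remainder quotient \<open>Q\<close> is bounded by \<open>2 * C\<close> on
  \<open>{a..b}\<close> and tends to 0 off the finite set \<open>N\<close>, so dominated convergence
  applies. The set \<open>N\<close> accommodates the parameters at which the curve crosses the
  circle, where the kernel changes its formula.\<close>

lemma has_vector_derivative_lborel_integral:
  fixes F :: "real \<Rightarrow> real \<Rightarrow> complex"
  assumes lip: "\<And>y x. y \<in> S \<Longrightarrow> x \<in> {a..b} \<Longrightarrow> cmod (F y x - F y0 x) \<le> C * \<bar>y - y0\<bar>"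
    and cont: "\<And>y. y \<in> S \<Longrightarrow> continuous_on {a..b} (F y)"
    and y0: "y0 \<in> S"
    and N: "finite N"
    and deriv: "\<And>x. x \<in> {a..b} - N \<Longrightarrow> ((\<lambda>y. F y x) has_vector_derivative D x) (at y0 within S)"
    and D_meas: "D \<in> borel_measurable borel"
    and D_bound: "\<And>x. x \<in> {a..b} \<Longrightarrow> cmod (D x) \<le> C"
  shows "((\<lambda>y. \<integral>x. indicator {a..b} x *\<^sub>R F y x \<partial>lborel) has_vector_derivative
    (\<integral>x. indicator {a..b} x *\<^sub>R D x \<partial>lborel)) (at y0 within S)"
proof -
  define G where "G y x = indicator {a..b} x *\<^sub>R F y x" for y x
  define E where "E x = indicator {a..b} x *\<^sub>R D x" for x
  define Q where "Q y x = (1 / norm (y - y0)) *\<^sub>R (G y x - (G y0 x + (y - y0) *\<^sub>R E x))" for y x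
  have iG: "integrable lborel (G y)" if "y \<in> S" for y
    unfolding G_def using cont[OF that] by (intro borel_integrable_compact) auto
  have mE: "E \<in> borel_measurable lborel" using D_meas unfolding E_def by simp
  have iC: "integrable lborel (\<lambda>x. indicator {a..b} x *\<^sub>R c)" for c :: real
    by (intro borel_integrable_compact) auto
  have iE: "integrable lborel E"
    by (rule Bochner_Integration.integrable_bound[OF iC[of C] mE]) (use D_bound in \<open>force simp: E_def indicator_def intro!: AE_I2\<close>)
  have mQ: "Q y \<in> borel_measurable lborel" if "y \<in> S" for y
    unfolding Q_def using iG[OF that] iG[OF y0] iE by measurable
  have lim: "((\<lambda>y. \<integral>x. Q y x \<partial>lborel) \<longlongrightarrow> 0) (at y0 within S)"
    unfolding tendsto_at_iff_sequentially o_def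
  proof (intro allI impI)
    fix X :: "nat \<Rightarrow> real"
    assume XS: "\<forall>i. X i \<in> S - {y0}" and X: "X \<longlonglongrightarrow> y0"
    have "(\<lambda>i. \<integral>x. Q (X i) x \<partial>lborel) \<longlonglongrightarrow> (\<integral>x. (0::complex) \<partial>(lborel :: real measure))"
    proof (rule integral_dominated_convergence)
      show "(\<lambda>x. 0) \<in> borel_measurable lborel" by simp
      show "Q (X i) \<in> borel_measurable lborel" for i using mQ XS by auto
      show "integrable lborel (\<lambda>x. indicator {a..b} x *\<^sub>R (2 * C))" by (rule iC)
      have "AE x in lborel. x \<notin> N"
        using N by (intro AE_not_in) (simp add: finite_imp_null_set_lborel)
      then show "AE x in lborel. (\<lambda>i. Q (X i) x) \<longlonglongrightarrow> 0"
      proof eventually_elim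
        case (elim x)
        show ?case
        proof (cases "x \<in> {a..b}")
          case True
          have "((\<lambda>y. (1 / norm (y - y0)) *\<^sub>R (F y x - (F y0 x + (y - y0) *\<^sub>R D x))) \<longlongrightarrow> 0) (at y0 within S)"
            using deriv[of x] True elim by (simp add: has_vector_derivative_def has_derivative_within)
          then show ?thesis using XS X True
            unfolding tendsto_at_iff_sequentially o_def by (auto simp: Q_def G_def E_def)
        qed (simp add: Q_def G_def E_def)
      qed
      show "AE x in lborel. norm (Q (X i) x) \<le> indicator {a..b} x *\<^sub>R (2 * C)" for i
      proof (rule AE_I2)
        fix x :: real
        have Xi: "X i \<in> S" "X i \<noteq> y0" using XS by auto
        show "norm (Q (X i) x) \<le> indicator {a..b} x *\<^sub>R (2 * C)"
        proof (cases "x \<in> {a..b}")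
          case True
          have "norm (F (X i) x - (F y0 x + (X i - y0) *\<^sub>R D x)) \<le> norm (F (X i) x - F y0 x) + norm ((X i - y0) *\<^sub>R D x)"
            by (metis norm_triangle_ineq4 diff_diff_eq)
          also have "\<dots> \<le> C * \<bar>X i - y0\<bar> + \<bar>X i - y0\<bar> * C"
            using lip[OF Xi(1) True] D_bound[OF True] by (intro add_mono) (auto intro: mult_left_mono)
          finally have "norm (F (X i) x - (F y0 x + (X i - y0) *\<^sub>R D x)) \<le> 2 * C * \<bar>X i - y0\<bar>"
            by (simp add: mult_ac)
          moreover have "norm (Q (X i) x) = norm (F (X i) x - (F y0 x + (X i - y0) *\<^sub>R D x)) / \<bar>X i - y0\<bar>"
            unfolding Q_def norm_scaleR using True by (simp add: G_def E_def)
          ultimately show ?thesis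
            using True Xi by (simp add: pos_divide_le_eq)
        qed (simp add: Q_def G_def E_def)
      qed
    qed
    then show "(\<lambda>i. \<integral>x. Q (X i) x \<partial>lborel) \<longlonglongrightarrow> 0" by simp
  qed
  have intQ: "(\<integral>x. Q y x \<partial>lborel) = (1 / norm (y - y0)) *\<^sub>R ((\<integral>x. G y x \<partial>lborel) - ((\<integral>x. G y0 x \<partial>lborel) + (y - y0) *\<^sub>R (\<integral>x. E x \<partial>lborel)))"
    if "y \<in> S" for y
    unfolding Q_def using iG[OF that] iG[OF y0] iE by simp
  have "((\<lambda>y. (1 / norm (y - y0)) *\<^sub>R ((\<integral>x. G y x \<partial>lborel) - ((\<integral>x. G y0 x \<partial>lborel) + (y - y0) *\<^sub>R (\<integral>x. E x \<partial>lborel)))) \<longlongrightarrow> 0) (at y0 within S)"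
    using lim by (rule Lim_transform_eventually) (auto simp: eventually_at_filter intQ)
  then show ?thesis
    unfolding has_vector_derivative_def has_derivative_within G_def E_def
    by (simp add: bounded_linear_scaleR_left)
qed

section \<open>Lipschitz bounds for the kernel\<close>

lemma kernel_inside: "cmod w \<le> r \<Longrightarrow> kernel r w = cnj w"
  using complex_norm_square[of w] by (cases "w = 0") (auto simp: kernel_def min_def)

lemma kernel_outside: "r \<le> cmod w \<Longrightarrow> kernel r w = of_real (r\<^sup>2) / w"
  by (auto simp: kernel_def min_def)

text \<open>The numerators differ by \<open>a\<^sup>2 - b\<^sup>2 = (a + b) * (a - b)\<close> for
  the truncated moduli \<open>a\<close> and \<open>b\<close>; the factor \<open>a + b\<close> is at
  most \<open>2 * cmod w\<close> and cancels the denominator.\<close>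

lemma kernel_Lipschitz_radius:
  assumes "0 < r" "0 < \<rho>"
  shows "cmod (kernel \<rho> w - kernel r w) \<le> 2 * \<bar>\<rho> - r\<bar>"
proof (cases "w = 0")
  case False
  define a b where "a = min (cmod w) \<rho>" and "b = min (cmod w) r"
  have ab: "0 \<le> a" "0 \<le> b" "a \<le> cmod w" "b \<le> cmod w" "\<bar>a - b\<bar> \<le> \<bar>\<rho> - r\<bar>"
    using assms by (auto simp: a_def b_def min_def)
  have "kernel \<rho> w - kernel r w = of_real ((a + b) * (a - b)) / w"
    by (simp add: kernel_def a_def b_def diff_divide_distrib[symmetric] power2_eq_square algebra_simps)
  then have "cmod (kernel \<rho> w - kernel r w) = (a + b) * \<bar>a - b\<bar> / cmod w"
    using ab by (simp only: norm_divide norm_of_real abs_mult)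
  also have "\<dots> \<le> (2 * cmod w) * \<bar>\<rho> - r\<bar> / cmod w"
    using ab by (intro divide_right_mono mult_mono) auto
  finally show ?thesis using False by simp
qed (simp add: kernel_def)

text \<open>Inside, the kernel is conjugation, an isometry; outside, \<open>r\<^sup>2 / w\<close>
  does not increase distances. A mixed pair is compared through the circle in three pieces, each at
  most \<open>cmod (v - w)\<close>.\<close>

lemma kernel_Lipschitz:
  assumes r: "0 < r"
  shows "cmod (kernel r v - kernel r w) \<le> 3 * cmod (v - w)"
proof -
  have mixed: "cmod (kernel r v - kernel r w) \<le> 3 * cmod (v - w)"
    if v: "cmod v \<le> r" and w: "r \<le> cmod w" for v w
  proof -
    \<comment> \<open>\<open>u\<close> is the radial projection of \<open>w\<close> to the circle;
      the kernel at \<open>w\<close> is the conjugate of \<open>u\<close> shrunk by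
      \<open>r / cmod w\<close>. Passing from \<open>w\<close> to \<open>u\<close> and from
      \<open>u\<close> to the shrunk point each costs at most \<open>cmod w - r\<close>, which is at
      most \<open>cmod (v - w)\<close>.\<close>
    define u where "u = of_real (r / cmod w) * w"
    have w0: "w \<noteq> 0" using w r by auto
    have u: "cmod u = r" using r w0 by (simp add: u_def norm_mult norm_divide)
    have ku: "kernel r w = cnj (of_real (r / cmod w) * u)"
      using w r w0 complex_norm_square[of w]
      by (simp add: kernel_outside u_def field_simps power2_eq_square)
    have wu: "cmod (w - u) = cmod w - r"
    proof -
      have "w - u = of_real (1 - r / cmod w) * w" by (simp add: u_def algebra_simps)
      then have "cmod (w - u) = (1 - r / cmod w) * cmod w" using w w0 by (simp add: norm_mult del: of_real_diff of_real_divide)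
      then show ?thesis using w0 by (simp add: left_diff_distrib)
    qed
    have uu: "cmod (u - of_real (r / cmod w) * u) \<le> cmod w - r"
    proof -
      have "u - of_real (r / cmod w) * u = of_real (1 - r / cmod w) * u" by (simp add: algebra_simps)
      then have "cmod (u - of_real (r / cmod w) * u) = (1 - r / cmod w) * r" using w w0 u by (simp add: norm_mult del: of_real_diff of_real_divide)
      also have "\<dots> \<le> (1 - r / cmod w) * cmod w" using w w0 by (intro mult_left_mono) auto
      also have "\<dots> = cmod w - r" using w0 by (simp add: left_diff_distrib)
      finally show ?thesis .
    qed
    have "cmod (kernel r v - kernel r w) = cmod (v - of_real (r / cmod w) * u)"
      unfolding kernel_inside[OF v] ku by (metis complex_cnj_diff complex_mod_cnj)
    also have "\<dots> \<le> cmod (v - w) + cmod (w - u) + cmod (u - of_real (r / cmod w) * u)"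
      by (smt (verit) norm_triangle_ineq diff_add_cancel add_diff_eq)
    also have "\<dots> \<le> cmod (v - w) + (cmod w - r) + (cmod w - r)" using wu uu by simp
    also have "\<dots> \<le> 3 * cmod (v - w)"
      using v norm_triangle_ineq3[of w v] norm_minus_commute[of v w] by linarith
    finally show ?thesis .
  qed
  show ?thesis
  proof (cases "cmod v \<le> r"; cases "cmod w \<le> r")
    assume "cmod v \<le> r" "cmod w \<le> r"
    then show ?thesis by (simp add: kernel_inside flip: complex_cnj_diff)
  next
    assume "\<not> cmod v \<le> r" "\<not> cmod w \<le> r"
    then have vw: "r \<le> cmod v" "r \<le> cmod w" "v \<noteq> 0" "w \<noteq> 0" using r by auto
    have "kernel r v - kernel r w = of_real (r\<^sup>2) * (w - v) / (v * w)"
      using vw by (simp add: kernel_outside field_simps)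
    then have "cmod (kernel r v - kernel r w) = r * r * cmod (v - w) / (cmod v * cmod w)"
      by (simp add: norm_mult norm_divide norm_minus_commute power2_eq_square)
    also have "\<dots> \<le> (cmod v * cmod w) * cmod (v - w) / (cmod v * cmod w)"
      using vw r by (intro divide_right_mono mult_right_mono mult_mono) auto
    also have "\<dots> \<le> 3 * cmod (v - w)" using vw by simp
    finally show ?thesis .
  qed (use mixed[of v w] mixed[of w v] in \<open>auto simp: norm_minus_commute\<close>)
qed

lemma continuous_on_kernel: "0 < r \<Longrightarrow> continuous_on A (kernel r)"
  by (rule lipschitz_on_continuous_on[of 3], rule lipschitz_onI)
     (auto simp: dist_norm kernel_Lipschitz)


section \<open>Derivatives in the radius and along the curve\<close>

context periodic_unit_speed
begin

text \<open>For a primitive \<open>g\<close> on \<open>{0..2 * L}\<close> the integral starting at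
  \<open>s\<close> is \<open>g (s + L) - g s\<close>, whose derivative in \<open>s\<close> vanishes
  by periodicity of \<open>f\<close>.\<close>

lemma integral_period:
  fixes f :: "real \<Rightarrow> complex"
  assumes f: "continuous_on UNIV f" and p: "\<And>x. f (x + L) = f x" and s: "s \<in> {0..L}"
  shows "(\<integral>x. indicator {0..L} x *\<^sub>R f (s + x) \<partial>lborel) = (\<integral>x. indicator {0..L} x *\<^sub>R f x \<partial>lborel)"
proof -
  obtain g where g: "\<And>x. x \<in> {0..2 * L} \<Longrightarrow> (g has_vector_derivative f x) (at x within {0..2 * L})"
    using antiderivative_continuous[of 0 "2 * L" f] f continuous_on_subset by blast
  have sh: "((\<lambda>x. g (t + x)) has_vector_derivative f (t + x)) (at x within {0..L})"
    if "t \<in> {0..L}" "x \<in> {0..L}" for t x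
  proof -
    have "((g \<circ> (\<lambda>x. t + x)) has_vector_derivative 1 *\<^sub>R f (t + x)) (at x within {0..L})"
      by (rule vector_diff_chain_within)
        (use that in \<open>auto intro!: derivative_eq_intros has_vector_derivative_within_subset[OF g]\<close>)
    then show ?thesis by (simp add: o_def)
  qed
  have cf: "continuous_on {0..L} (\<lambda>x. f (t + x))" for t
    by (rule continuous_on_compose2[OF f]) (auto intro!: continuous_intros)
  have I: "(\<integral>x. indicator {0..L} x *\<^sub>R f (t + x) \<partial>lborel) = g (t + L) - g t" if "t \<in> {0..L}" for t
    using integral_FTC_atLeastAtMost[of 0 L "\<lambda>x. g (t + x)" "\<lambda>x. f (t + x)"] L_pos sh[OF that] cf
    by auto
  have "((\<lambda>t. g (t + L) - g t) has_vector_derivative 0) (at t within {0..L})" if "t \<in> {0..L}" for t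
  proof -
    have "((\<lambda>x. g (L + x) - g (0 + x)) has_vector_derivative f (L + t) - f (0 + t)) (at t within {0..L})"
      using that L_pos by (intro has_vector_derivative_diff sh) auto
    then show ?thesis using p[of t] by (simp add: add.commute)
  qed
  then have "g (s + L) - g s = g (0 + L) - g 0"
    using has_derivative_zero_constant[of "{0..L}" "\<lambda>t. g (t + L) - g t"] s L_pos
    by (auto simp: has_vector_derivative_def) (metis atLeastAtMost_iff less_imp_le order_refl add_0)
  then show ?thesis using I[OF s] I[of 0] L_pos by simp
qed

text \<open>The start \<open>s\<close> of the integration is separate from the parameter
  \<open>\<sigma>\<close> of the centre, so the integration variable stays put while the centre
  moves. Starting at the undisplaced centre will make the part outside the disk a single
  interval.\<close>

lemma disk_area_eq:
  assumes ccw: "ccw_arclength_boundary \<Omega> L \<gamma>" and \<rho>: "0 < \<rho>" and s: "s \<in> {0..L}"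
  shows "of_real (disk_area \<Omega> \<gamma> \<sigma> \<rho>) = (\<integral>x. indicator {0..L} x *\<^sub>R (kernel \<rho> (\<gamma> (s + x) - \<gamma> \<sigma>) * T (s + x)) \<partial>lborel) / (2 * \<i>)"
proof -
  have "(\<integral>x. indicator {0..L} x *\<^sub>R (kernel \<rho> (\<gamma> (s + x) - \<gamma> \<sigma>) * T (s + x)) \<partial>lborel)
     = (\<integral>x. indicator {0..L} x *\<^sub>R (kernel \<rho> (\<gamma> x - \<gamma> \<sigma>) * T x) \<partial>lborel)"
    by (rule integral_period[OF _ _ s])
       (auto simp: per per_T intro!: continuous_intros continuous_on_compose2[OF continuous_on_kernel[OF \<rho>, of UNIV]] cont cont_T)
  then show ?thesis unfolding disk_area_def using area_formula[OF ccw \<rho>] by simp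
qed

text \<open>Both offsets are measured forwards from \<open>s\<close>: the curve leaves the disk at
  \<open>b\<close>, re-enters it at \<open>c\<close>, and \<open>L - c\<close> is the length of the
  arc behind \<open>s\<close>.\<close>

definition two_arc :: "real \<Rightarrow> real \<Rightarrow> real \<Rightarrow> real \<Rightarrow> bool" where
  "two_arc s r b c \<longleftrightarrow> 0 < b \<and> b < c \<and> c < L \<and>
     (\<forall>x\<in>{0..<b} \<union> {c<..L}. cmod (\<gamma> (s + x) - \<gamma> s) < r) \<and>
     (\<forall>x\<in>{b<..<c}. r < cmod (\<gamma> (s + x) - \<gamma> s)) \<and>
     cmod (\<gamma> (s + b) - \<gamma> s) = r \<and> cmod (\<gamma> (s + c) - \<gamma> s) = r"

lemma has_vector_derivative_shift: "((\<lambda>x. \<gamma> (s + x)) has_vector_derivative T (s + x)) (at x within A)"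
proof -
  have "((\<gamma> \<circ> (\<lambda>x. s + x)) has_vector_derivative 1 *\<^sub>R T (s + x)) (at x within A)"
    by (rule vector_diff_chain_within)
       (auto intro!: derivative_eq_intros has_vector_derivative_at_within[OF deriv])
  then show ?thesis by (simp add: o_def)
qed

lemma measurable_gamma_T [measurable]: "\<gamma> \<in> borel_measurable borel" "T \<in> borel_measurable borel"
  using cont[of UNIV] cont_T by (auto intro: borel_measurable_continuous_onI)

text \<open>\<open>J\<close> is the increment of a continuous logarithm of
  \<open>\<gamma> (s + x) - \<gamma> s\<close> along the outer arc, so \<open>exp J\<close> is the
  ratio of its end values. Both lie on the circle, hence \<open>Re J = 0\<close> and only the angle
  remains.\<close>

lemma two_arc_integral_exp:
  assumes ta: "two_arc s r b c" and r: "0 < r"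
  defines "J \<equiv> (\<integral>x. indicator {b..c} x *\<^sub>R (T (s + x) / (\<gamma> (s + x) - \<gamma> s)) \<partial>lborel)"
  shows "exp (\<i> * Im J) = (\<gamma> (s + c) - \<gamma> s) / (\<gamma> (s + b) - \<gamma> s)"
proof -
  have bc: "b < c" and db: "cmod (\<gamma> (s + b) - \<gamma> s) = r" and dc: "cmod (\<gamma> (s + c) - \<gamma> s) = r"
    and gt: "\<And>x. x \<in> {b..c} \<Longrightarrow> r \<le> cmod (\<gamma> (s + x) - \<gamma> s)"
    using ta by (auto simp: two_arc_def) (metis atLeastAtMost_iff greaterThanLessThan_iff less_le order_refl)
  have nz: "\<gamma> (s + x) - \<gamma> s \<noteq> 0" if "x \<in> {b..c}" for x using gt[OF that] r by auto
  have vd: "vector_derivative (\<lambda>x. \<gamma> (s + x)) (at x) = T (s + x)" for x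
    using has_vector_derivative_shift by (rule vector_derivative_at)
  have "(\<lambda>x. \<gamma> (s + x)) C1_differentiable_on {b..c}"
    unfolding C1_differentiable_on_def
    using has_vector_derivative_shift
    by (intro exI[of _ "\<lambda>x. T (s + x)"]) (auto intro!: continuous_intros continuous_on_compose2[OF cont_T])
  then have pc: "(\<lambda>x. \<gamma> (s + x)) piecewise_C1_differentiable_on {b..c}"
    by (rule C1_differentiable_imp_piecewise)
  have c: "continuous_on {b..c} (\<lambda>x. T (s + x) / (\<gamma> (s + x) - \<gamma> s))"
    using nz by (auto intro!: continuous_intros continuous_on_compose2[OF cont_T] continuous_on_compose2[OF cont[of UNIV]])
  then have si: "set_integrable lborel {b..c} (\<lambda>x. T (s + x) / (\<gamma> (s + x) - \<gamma> s))"
    unfolding set_integrable_def by (intro borel_integrable_compact) auto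
  have J: "J = integral {b..c} (\<lambda>x. T (s + x) / (\<gamma> (s + x) - \<gamma> s))"
    using set_borel_integral_eq_integral(2)[OF si] by (simp add: J_def set_lebesgue_integral_def)
  have "exp (- J) * (\<gamma> (s + c) - \<gamma> s) = \<gamma> (s + b) - \<gamma> s"
  proof -
    have "\<gamma> s \<notin> (\<lambda>x. \<gamma> (s + x)) ` {b..c}"
    proof
      assume "\<gamma> s \<in> (\<lambda>x. \<gamma> (s + x)) ` {b..c}"
      then obtain x where "x \<in> {b..c}" "\<gamma> s = \<gamma> (s + x)" by auto
      then show False using nz[of x] by simp
    qed
    from winding_number_exp_integral(2)[OF pc _ this] show ?thesis
      using bc by (simp add: vd J)
  qed
  then have e: "exp J = (\<gamma> (s + c) - \<gamma> s) / (\<gamma> (s + b) - \<gamma> s)"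
    using nz[of b] bc by (simp add: exp_minus field_simps)
  then have "cmod (exp J) = 1" using db dc r by (simp add: norm_divide)
  then have "Re J = 0" by simp
  then have "J = \<i> * Im J" by (simp add: complex_eq_iff)
  then show ?thesis using e by simp
qed

text \<open>Inside the disk the kernel is \<open>cnj w\<close>, independent of the radius; outside,
  \<open>\<rho>\<^sup>2 / w\<close> has derivative \<open>2 * r / w\<close> at \<open>r\<close>.
  After division by \<open>2 * \<i>\<close> the area derivative is \<open>r * Im J\<close>, that is,
  \<open>r\<close> times the angle swept along the outer arc.\<close>

lemma disk_area_has_derivative_radius:
  assumes ccw: "ccw_arclength_boundary \<Omega> L \<gamma>" and r: "0 < r" and s: "s \<in> {0..L}" and ta: "two_arc s r b c"
  shows "exp (\<i> * (disk_area_dr \<Omega> \<gamma> s r / r)) = (\<gamma> (s + c) - \<gamma> s) / (\<gamma> (s + b) - \<gamma> s)"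
proof -
  define w where "w x = \<gamma> (s + x) - \<gamma> s" for x
  have cw: "continuous_on A w" for A
    unfolding w_def by (auto intro!: continuous_intros continuous_on_compose2[OF cont[of UNIV]])
  define D where "D x = (if r < cmod (w x) then 2 * r * (T (s + x) / w x) else 0)" for x
  define J where "J = (\<integral>x. indicator {b..c} x *\<^sub>R (T (s + x) / w x) \<partial>lborel)"
  have TA: "0 < b" "b < c" "c < L" "\<And>x. 0 \<le> x \<Longrightarrow> x < b \<Longrightarrow> cmod (w x) < r" "\<And>x. c < x \<Longrightarrow> x \<le> L \<Longrightarrow> cmod (w x) < r"
    "\<And>x. b < x \<Longrightarrow> x < c \<Longrightarrow> r < cmod (w x)" "cmod (w b) = r" "cmod (w c) = r"
    using ta by (auto simp: two_arc_def w_def)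
  have dint: "((\<lambda>\<rho>. \<integral>x. indicator {0..L} x *\<^sub>R (kernel \<rho> (w x) * T (s + x)) \<partial>lborel) has_vector_derivative
     (\<integral>x. indicator {0..L} x *\<^sub>R D x \<partial>lborel)) (at r within {0<..})"
  \<comment> \<open>The constant 2 also bounds \<open>D\<close>, since \<open>cmod (w x) > r\<close>
    wherever \<open>D\<close> is nonzero; at \<open>b\<close> and \<open>c\<close> the curve meets
    the circle.\<close>
  proof (rule has_vector_derivative_lborel_integral[where C = 2 and N = "{b, c}"])
    fix \<rho> x :: real assume "\<rho> \<in> {0<..}"
    then have "cmod (kernel \<rho> (w x) - kernel r (w x)) \<le> 2 * \<bar>\<rho> - r\<bar>"
      using r by (intro kernel_Lipschitz_radius) auto
    then show "cmod (kernel \<rho> (w x) * T (s + x) - kernel r (w x) * T (s + x)) \<le> 2 * \<bar>\<rho> - r\<bar>"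
      by (simp add: norm_T norm_mult flip: left_diff_distrib)
    show "continuous_on {0..L} (\<lambda>x. kernel \<rho> (w x) * T (s + x))"
      using \<open>\<rho> \<in> {0<..}\<close>
      by (auto intro!: continuous_intros continuous_on_compose2[OF continuous_on_kernel[of \<rho> UNIV]] cw continuous_on_compose2[OF cont_T])
  next
    fix x assume x: "x \<in> {0..L} - {b, c}"
    then have "cmod (w x) < r \<or> r < cmod (w x)"
      using TA(4-6)[of x] by (cases "x < b"; cases "c < x") auto
    then consider "cmod (w x) < r" | "r < cmod (w x)" by blast
    then have "((\<lambda>\<rho>. kernel \<rho> (w x) * T (s + x)) has_vector_derivative D x) (at r)"
    proof cases
      case 1
      have "((\<lambda>\<rho>. cnj (w x) * T (s + x)) has_vector_derivative D x) (at r)"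
        using 1 by (simp add: D_def)
      then show ?thesis
        by (rule has_vector_derivative_transform_within_open[where S = "{cmod (w x)<..}"])
           (use 1 in \<open>auto simp: kernel_inside\<close>)
    next
      case 2
      have "((\<lambda>\<rho>. \<rho>\<^sup>2) has_real_derivative 2 * r) (at r)"
        by (auto intro!: derivative_eq_intros)
      then have "((\<lambda>\<rho>. of_real (\<rho>\<^sup>2) * (T (s + x) / w x)) has_vector_derivative of_real (2 * r) * (T (s + x) / w x)) (at r)"
        by (intro has_vector_derivative_mult_left has_vector_derivative_of_real)
           (simp add: has_real_derivative_iff_has_vector_derivative)
      then have "((\<lambda>\<rho>. of_real (\<rho>\<^sup>2) * (T (s + x) / w x)) has_vector_derivative D x) (at r)"
        using 2 by (simp add: D_def)
      then show ?thesis
        by (rule has_vector_derivative_transform_within_open[where S = "{..<cmod (w x)}"])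
           (use 2 in \<open>auto simp: kernel_outside\<close>)
    qed
    then show "((\<lambda>\<rho>. kernel \<rho> (w x) * T (s + x)) has_vector_derivative D x) (at r within {0<..})"
      by (rule has_vector_derivative_at_within)
  next
    show "D \<in> borel_measurable borel" unfolding D_def w_def by measurable
    show "cmod (D x) \<le> 2" for x
    proof (cases "r < cmod (w x)")
      case True
      then have "w x \<noteq> 0" using r by auto
      then show ?thesis using True r by (simp add: D_def norm_mult norm_divide norm_T divide_le_eq)
    qed (simp add: D_def)
  qed (use r in auto)
  have at: "at r within {0<..} = at r" using r by (intro at_within_open) auto
  have "(\<integral>x. indicator {0..L} x *\<^sub>R D x \<partial>lborel) = (\<integral>x. of_real (2 * r) * (indicator {b..c} x *\<^sub>R (T (s + x) / w x)) \<partial>lborel)"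
  proof (rule Bochner_Integration.integral_cong_AE)
    have "AE x in lborel. x \<notin> {b, c}"
      by (intro AE_not_in finite_imp_null_set_lborel) simp
    then show "AE x in lborel. indicator {0..L} x *\<^sub>R D x = of_real (2 * r) * (indicator {b..c} x *\<^sub>R (T (s + x) / w x))"
    proof eventually_elim
      case (elim x)
      then have "x \<noteq> b" "x \<noteq> c" by auto
      then consider "x < 0" | "0 \<le> x" "x < b" | "b < x" "x < c" | "c < x" "x \<le> L" | "L < x" by linarith
      then show ?case
        by cases (use TA(1-3) TA(4-6)[of x] in \<open>auto simp: D_def indicator_def\<close>)
    qed
  qed (unfold D_def w_def, measurable)
  also have "\<dots> = of_real (2 * r) * J"
    unfolding J_def by (rule integral_mult_right_zero)
  finally have I: "(\<integral>x. indicator {0..L} x *\<^sub>R D x \<partial>lborel) = of_real (2 * r) * J" .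
  have "((\<lambda>\<rho>. (\<integral>x. indicator {0..L} x *\<^sub>R (kernel \<rho> (w x) * T (s + x)) \<partial>lborel) / (2 * \<i>)) has_vector_derivative
    of_real (2 * r) * J / (2 * \<i>)) (at r)"
    using has_vector_derivative_divide[OF dint, of "2 * \<i>"] unfolding at I .
  then have "((\<lambda>\<rho>. of_real (disk_area \<Omega> \<gamma> s \<rho>) :: complex) has_vector_derivative of_real (2 * r) * J / (2 * \<i>)) (at r)"
    by (rule has_vector_derivative_transform_within_open[where S = "{0<..}"])
       (use r disk_area_eq[OF ccw _ s, of _ s] in \<open>auto simp: w_def\<close>)
  from bounded_linear.has_vector_derivative[OF bounded_linear_Re this]
  have "((\<lambda>\<rho>. disk_area \<Omega> \<gamma> s \<rho>) has_vector_derivative r * Im J) (at r)"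
    by (simp add: complex_eq_iff Re_divide)
  then have "disk_area_dr \<Omega> \<gamma> s r = r * Im J"
    unfolding disk_area_dr_def by (rule vector_derivative_at)
  then show ?thesis
    using two_arc_integral_exp[OF ta r] r by (simp add: J_def w_def)
qed

lemma gamma_Lipschitz: "cmod (\<gamma> s - \<gamma> t) \<le> \<bar>s - t\<bar>"
  using differentiable_bound[of UNIV \<gamma> "\<lambda>x h. h *\<^sub>R T x" 1 s t] deriv
  by (simp add: has_vector_derivative_def norm_T onorm_scaleR_left bounded_linear_ident onorm_id)

text \<open>\<open>D\<close> has explicit primitives: \<open>- cnj (T s) * w x\<close> on the inner
  arcs and \<open>- r\<^sup>2 * T s / w x\<close> on the outer one. The first vanishes at the
  offsets 0 and \<open>L\<close>, where the curve is at its centre, so only the values at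
  \<open>b\<close> and \<open>c\<close> survive.\<close>

lemma two_arc_integral_variation:
  assumes ta: "two_arc s r b c" and r: "0 < r"
  defines "w \<equiv> \<lambda>x. \<gamma> (s + x) - \<gamma> s"
  defines "D \<equiv> \<lambda>x. T (s + x) * (if r < cmod (w x) then of_real (r\<^sup>2) * T s / (w x)\<^sup>2 else - cnj (T s))"
  shows "(\<integral>x. indicator {0..L} x *\<^sub>R D x \<partial>lborel)
    = T s * (of_real (r\<^sup>2) / w b - of_real (r\<^sup>2) / w c) - cnj (T s) * (w b - w c)"
proof -
  have TA: "0 < b" "b < c" "c < L" "\<And>x. 0 \<le> x \<Longrightarrow> x < b \<Longrightarrow> cmod (w x) < r" "\<And>x. c < x \<Longrightarrow> x \<le> L \<Longrightarrow> cmod (w x) < r"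
    "\<And>x. b < x \<Longrightarrow> x < c \<Longrightarrow> r < cmod (w x)" "cmod (w b) = r" "cmod (w c) = r"
    using ta by (auto simp: two_arc_def w_def)
  have dw: "(w has_vector_derivative T (s + x)) (at x within A)" for x A
    unfolding w_def using has_vector_derivative_diff[OF has_vector_derivative_shift has_vector_derivative_const] by simp
  have cw: "continuous_on A w" for A
    unfolding w_def by (auto intro!: continuous_intros continuous_on_compose2[OF cont[of UNIV]])
  have cTs: "continuous_on A (\<lambda>x. T (s + x))" for A
    by (auto intro!: continuous_intros continuous_on_compose2[OF cont_T])
  have nz: "w x \<noteq> 0" if "x \<in> {b..c}" for x
    using that TA(6)[of x] TA(7,8) r by (cases "x = b"; cases "x = c") auto
  define D1 where "D1 x = T (s + x) * (- cnj (T s))" for x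
  define D2 where "D2 x = T (s + x) * (of_real (r\<^sup>2) * T s / (w x)\<^sup>2)" for x
  have I1: "has_bochner_integral lborel (\<lambda>x. indicator {p..q} x *\<^sub>R D1 x) (w q * (- cnj (T s)) - w p * (- cnj (T s)))"
    if "p \<le> q" for p q
  proof (rule has_bochner_integral_FTC_Icc[OF that])
    show "((\<lambda>x. w x * (- cnj (T s))) has_vector_derivative D1 x) (at x within {p..q})" for x
      unfolding D1_def by (rule has_vector_derivative_mult_left[OF dw])
    show "continuous_on {p..q} D1" unfolding D1_def by (intro continuous_intros cTs)
  qed
  have I2: "has_bochner_integral lborel (\<lambda>x. indicator {b..c} x *\<^sub>R D2 x) (- (of_real (r\<^sup>2) * T s) / w c - (- (of_real (r\<^sup>2) * T s) / w b))"
  proof (rule has_bochner_integral_FTC_Icc)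
    fix x assume "b \<le> x" "x \<le> c"
    then have "w x \<noteq> 0" by (intro nz) auto
    then have "((\<lambda>z. - (of_real (r\<^sup>2) * T s) / z) has_field_derivative of_real (r\<^sup>2) * T s / (w x)\<^sup>2) (at (w x) within w ` {b..c})"
      by (auto intro!: derivative_eq_intros simp: power2_eq_square field_simps)
    from field_vector_diff_chain_within[OF dw this]
    show "((\<lambda>x. - (of_real (r\<^sup>2) * T s) / w x) has_vector_derivative D2 x) (at x within {b..c})"
      by (simp add: o_def D2_def)
  next
    show "continuous_on {b..c} D2" unfolding D2_def using nz by (intro continuous_intros cTs cw) auto
  qed (use TA in simp)
  have "(\<integral>x. indicator {0..L} x *\<^sub>R D x \<partial>lborel) =
     (\<integral>x. indicator {0..b} x *\<^sub>R D1 x + indicator {b..c} x *\<^sub>R D2 x + indicator {c..L} x *\<^sub>R D1 x \<partial>lborel)"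
  proof (rule Bochner_Integration.integral_cong_AE)
    have "AE x in lborel. x \<notin> {b, c}"
      by (intro AE_not_in finite_imp_null_set_lborel) simp
    then show "AE x in lborel. indicator {0..L} x *\<^sub>R D x = indicator {0..b} x *\<^sub>R D1 x + indicator {b..c} x *\<^sub>R D2 x + indicator {c..L} x *\<^sub>R D1 x"
    proof eventually_elim
      case (elim x)
      then have "x \<noteq> b" "x \<noteq> c" by auto
      then consider "x < 0" | "0 \<le> x" "x < b" | "b < x" "x < c" | "c < x" "x \<le> L" | "L < x" by linarith
      then show ?case
        by cases (use TA(1-3) TA(4-6)[of x] in \<open>auto simp: D_def D1_def D2_def indicator_def\<close>)
    qed
  qed (unfold D_def D1_def D2_def w_def, measurable)
  also have "\<dots> = (w b * (- cnj (T s)) - w 0 * (- cnj (T s))) + (- (of_real (r\<^sup>2) * T s) / w c - (- (of_real (r\<^sup>2) * T s) / w b))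
      + (w L * (- cnj (T s)) - w c * (- cnj (T s)))"
    using TA by (intro has_bochner_integral_integral_eq has_bochner_integral_add I1 I2) auto
  also have "\<dots> = T s * (of_real (r\<^sup>2) / w b - of_real (r\<^sup>2) / w c) - cnj (T s) * (w b - w c)"
    using per[of s] by (simp add: w_def algebra_simps)
  finally show ?thesis .
qed

text \<open>\<open>D\<close> is the derivative of the integrand when the centre moves with velocity
  \<open>T s\<close>. On the circle \<open>r\<^sup>2 / w\<close> equals \<open>cnj w\<close>, so the
  boundary terms form the difference of a number and its conjugate, leaving an imaginary part after
  division by \<open>2 * \<i>\<close>.\<close>

lemma disk_area_has_derivative_arclength:
  assumes ccw: "ccw_arclength_boundary \<Omega> L \<gamma>" and r: "0 < r" and s: "s \<in> {0..L}" and ta: "two_arc s r b c"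
  shows "disk_area_ds \<Omega> L \<gamma> s r = Im (cnj (T s) * (\<gamma> (s + c) - \<gamma> (s + b)))"
proof -
  define w where "w x = \<gamma> (s + x) - \<gamma> s" for x
  define D where "D x = T (s + x) * (if r < cmod (w x) then of_real (r\<^sup>2) * T s / (w x)\<^sup>2 else - cnj (T s))" for x
  have TA: "0 < b" "b < c" "c < L" "\<And>x. 0 \<le> x \<Longrightarrow> x < b \<Longrightarrow> cmod (w x) < r" "\<And>x. c < x \<Longrightarrow> x \<le> L \<Longrightarrow> cmod (w x) < r"
    "\<And>x. b < x \<Longrightarrow> x < c \<Longrightarrow> r < cmod (w x)" "cmod (w b) = r" "cmod (w c) = r"
    using ta by (auto simp: two_arc_def w_def)
  have "((\<lambda>\<sigma>. \<integral>x. indicator {0..L} x *\<^sub>R (kernel r (\<gamma> (s + x) - \<gamma> \<sigma>) * T (s + x)) \<partial>lborel) has_vector_derivative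
     (\<integral>x. indicator {0..L} x *\<^sub>R D x \<partial>lborel)) (at s within {0..L})"
  proof (rule has_vector_derivative_lborel_integral[where C = 3 and N = "{b, c}"])
    fix \<sigma> x :: real
    have "cmod (kernel r (\<gamma> (s + x) - \<gamma> \<sigma>) - kernel r (\<gamma> (s + x) - \<gamma> s)) \<le> 3 * cmod (\<gamma> s - \<gamma> \<sigma>)"
      using kernel_Lipschitz[OF r, of "\<gamma> (s + x) - \<gamma> \<sigma>" "\<gamma> (s + x) - \<gamma> s"] by simp
    also have "\<dots> \<le> 3 * \<bar>\<sigma> - s\<bar>" using gamma_Lipschitz[of \<sigma> s] by (simp add: norm_minus_commute)
    finally show "cmod (kernel r (\<gamma> (s + x) - \<gamma> \<sigma>) * T (s + x) - kernel r (\<gamma> (s + x) - \<gamma> s) * T (s + x)) \<le> 3 * \<bar>\<sigma> - s\<bar>"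
      by (simp add: norm_T norm_mult flip: left_diff_distrib)
    show "continuous_on {0..L} (\<lambda>x. kernel r (\<gamma> (s + x) - \<gamma> \<sigma>) * T (s + x))"
      by (auto intro!: continuous_intros continuous_on_compose2[OF continuous_on_kernel[OF r, of UNIV]] continuous_on_compose2[OF cont[of UNIV]] continuous_on_compose2[OF cont_T])
  next
    fix x assume x: "x \<in> {0..L} - {b, c}"
    then have "cmod (w x) < r \<or> r < cmod (w x)"
      using TA(4-6)[of x] by (cases "x < b"; cases "c < x") auto
    have dv: "((\<lambda>\<sigma>. \<gamma> (s + x) - \<gamma> \<sigma>) has_vector_derivative - T s) (at s)"
      using has_vector_derivative_diff[OF has_vector_derivative_const deriv] by simp
    \<comment> \<open>Being strictly inside or strictly outside is an open condition on the centre,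
      so one formula for the kernel applies near \<open>s\<close>.\<close>
    have cv: "continuous_on UNIV (\<lambda>\<sigma>. cmod (\<gamma> (s + x) - \<gamma> \<sigma>))"
      by (intro continuous_intros cont)
    from \<open>cmod (w x) < r \<or> r < cmod (w x)\<close>
    have "((\<lambda>\<sigma>. kernel r (\<gamma> (s + x) - \<gamma> \<sigma>) * T (s + x)) has_vector_derivative D x) (at s)"
    proof
      assume 1: "cmod (w x) < r"
      have "((\<lambda>\<sigma>. cnj (\<gamma> (s + x) - \<gamma> \<sigma>) * T (s + x)) has_vector_derivative cnj (- T s) * T (s + x)) (at s)"
        by (intro has_vector_derivative_mult_left has_vector_derivative_cnj dv)
      then have "((\<lambda>\<sigma>. cnj (\<gamma> (s + x) - \<gamma> \<sigma>) * T (s + x)) has_vector_derivative D x) (at s)"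
        using 1 by (simp add: D_def mult.commute)
      then show ?thesis
        by (rule has_vector_derivative_transform_within_open[where S = "{\<sigma>. cmod (\<gamma> (s + x) - \<gamma> \<sigma>) < r}"])
           (use 1 cv in \<open>auto simp: kernel_inside w_def intro!: open_Collect_less continuous_on_const\<close>)
    next
      assume 2: "r < cmod (w x)"
      then have "\<gamma> (s + x) - \<gamma> s \<noteq> 0" using r by (auto simp: w_def)
      then have "((\<lambda>z. of_real (r\<^sup>2) / z) has_field_derivative - of_real (r\<^sup>2) / (\<gamma> (s + x) - \<gamma> s)\<^sup>2) (at (\<gamma> (s + x) - \<gamma> s) within (\<lambda>\<sigma>. \<gamma> (s + x) - \<gamma> \<sigma>) ` UNIV)"
        by (auto intro!: derivative_eq_intros simp: power2_eq_square field_simps)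
      from has_vector_derivative_mult_left[OF field_vector_diff_chain_within[OF dv this], of "T (s + x)"]
      have "((\<lambda>\<sigma>. of_real (r\<^sup>2) / (\<gamma> (s + x) - \<gamma> \<sigma>) * T (s + x)) has_vector_derivative D x) (at s)"
        using 2 by (simp add: o_def D_def w_def mult_ac)
      then show ?thesis
        by (rule has_vector_derivative_transform_within_open[where S = "{\<sigma>. r < cmod (\<gamma> (s + x) - \<gamma> \<sigma>)}"])
           (use 2 cv in \<open>auto simp: kernel_outside w_def intro!: open_Collect_less continuous_on_const\<close>)
    qed
    then show "((\<lambda>\<sigma>. kernel r (\<gamma> (s + x) - \<gamma> \<sigma>) * T (s + x)) has_vector_derivative D x) (at s within {0..L})"
      by (rule has_vector_derivative_at_within)
  next
    show "D \<in> borel_measurable borel" unfolding D_def w_def by measurable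
    show "cmod (D x) \<le> 3" for x
    proof (cases "r < cmod (w x)")
      case True
      then have "r\<^sup>2 \<le> (cmod (w x))\<^sup>2" using r by (intro power_mono) auto
      then have "r\<^sup>2 \<le> 3 * (cmod (w x))\<^sup>2" using zero_le_power2[of "cmod (w x)"] by linarith
      moreover have "w x \<noteq> 0" using True r by auto
      ultimately show ?thesis using True by (simp add: D_def norm_mult norm_divide norm_T norm_power divide_le_eq)
    qed (simp add: D_def norm_mult norm_T)
  qed (use s in auto)
  from has_vector_derivative_divide[OF this, of "2 * \<i>"]
  have "((\<lambda>\<sigma>. of_real (disk_area \<Omega> \<gamma> \<sigma> r) :: complex) has_vector_derivative (\<integral>x. indicator {0..L} x *\<^sub>R D x \<partial>lborel) / (2 * \<i>)) (at s within {0..L})"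
    using disk_area_eq[OF ccw r s] by simp
  from bounded_linear.has_vector_derivative[OF bounded_linear_Re this]
  have "((\<lambda>\<sigma>. disk_area \<Omega> \<gamma> \<sigma> r) has_vector_derivative Re ((\<integral>x. indicator {0..L} x *\<^sub>R D x \<partial>lborel) / (2 * \<i>))) (at s within {0..L})"
    by simp
  then have "disk_area_ds \<Omega> L \<gamma> s r = Re ((\<integral>x. indicator {0..L} x *\<^sub>R D x \<partial>lborel) / (2 * \<i>))"
    unfolding disk_area_ds_def using s L_pos by (intro vector_derivative_within_closed_interval) auto
  also have "(\<integral>x. indicator {0..L} x *\<^sub>R D x \<partial>lborel) = T s * (of_real (r\<^sup>2) / w b - of_real (r\<^sup>2) / w c) - cnj (T s) * (w b - w c)"
    using two_arc_integral_variation[OF ta r] unfolding D_def w_def .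
  also have "of_real (r\<^sup>2) / w b = cnj (w b)"
    using TA(7) r complex_norm_square[of "w b"] by (auto simp: field_simps)
  also have "of_real (r\<^sup>2) / w c = cnj (w c)"
    using TA(8) r complex_norm_square[of "w c"] by (auto simp: field_simps)
  also have "Re ((T s * (cnj (w b) - cnj (w c)) - cnj (T s) * (w b - w c)) / (2 * \<i>)) = Im (cnj (T s) * (w c - w b))"
    by (simp add: Re_divide field_simps)
  finally show ?thesis by (simp add: w_def)
qed

end

section \<open>Two intersection points\<close>

text \<open>The maximum is a critical point, hence higher than \<open>R\<close>. Up to height
  \<open>r\<close> Rolle's theorem excludes repeated values on either flank, and between the two
  crossings a value at most \<open>r\<close> would produce an interior minimum, again a critical
  point.\<close>

lemma two_crossings:
  fixes d d' :: "real \<Rightarrow> real"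
  assumes L: "0 < L" and d: "\<And>x. (d has_real_derivative d' x) (at x)"
    and ends: "d 0 = 0" "d L = 0" and pos: "\<And>x. 0 < x \<Longrightarrow> x < L \<Longrightarrow> 0 < d x"
    and reg: "\<And>x. 0 < x \<Longrightarrow> x < L \<Longrightarrow> d x \<le> R \<Longrightarrow> d' x \<noteq> 0"
    and r: "0 < r" "r \<le> R"
  obtains b c where "0 < b" "b < c" "c < L" "d b = r" "d c = r"
    "strict_mono_on {0..b} d" "strict_antimono_on {c..L} d" "\<And>x. b < x \<Longrightarrow> x < c \<Longrightarrow> r < d x"
proof -
  have cd: "continuous_on A d" for A
    using d DERIV_isCont by (blast intro: continuous_at_imp_continuous_on)
  obtain m where m: "m \<in> {0..L}" "\<And>x. x \<in> {0..L} \<Longrightarrow> d x \<le> d m"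
    using continuous_attains_sup[of "{0..L}" d] cd L by auto
  have dm0: "0 < d m" using m(2)[of "L / 2"] pos[of "L / 2"] L by auto
  then have m': "0 < m" "m < L" using m(1) ends by (auto simp: less_le)
  have "d' m = 0"
    by (rule DERIV_local_max[OF d, of "min m (L - m)"]) (use m m' in \<open>auto simp: abs_if split: if_splits\<close>)
  then have dm: "R < d m" using reg[OF m'] by force
  have no_crit: False if h: "0 \<le> x" "x < y" "y \<le> L" "d x = d y" "\<And>z. x < z \<Longrightarrow> z < y \<Longrightarrow> d z \<le> R" for x y
  proof -
    obtain z where z: "x < z" "z < y" "(d has_real_derivative 0) (at z)"
      using Rolle[OF h(2,4) cd] d real_differentiable_def by blast
    then have "d' z = 0" using d DERIV_unique by blast
    then show False using reg[of z] h z by auto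
  qed
  \<comment> \<open>\<open>b\<close> is the first parameter before the maximum and \<open>c\<close>
    the last one after it with height at least \<open>r\<close>; by continuity that height is
    exactly \<open>r\<close>.\<close>
  define b where "b = Inf {x \<in> {0..m}. r \<le> d x}"
  define c where "c = Sup {x \<in> {m..L}. r \<le> d x}"
  have cl: "closed {x \<in> {p..q}. r \<le> d x}" for p q
    using continuous_closed_preimage[OF cd closed_atLeastAtMost, of "{r..}" p q]
    by (simp add: vimage_def Int_def conj_commute)
  have b: "b \<in> {x \<in> {0..m}. r \<le> d x}"
    unfolding b_def using m' dm r by (intro closed_contains_Inf cl) (auto intro!: exI[of _ m] bdd_belowI[of _ 0])
  have bl: "d x < r" if "0 \<le> x" "x < b" for x
  proof (rule ccontr)
    assume "\<not> d x < r"
    then have "b \<le> x" unfolding b_def using that b by (intro cInf_lower) (auto intro!: bdd_belowI[of _ 0])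
    then show False using that by simp
  qed
  have c: "c \<in> {x \<in> {m..L}. r \<le> d x}"
    unfolding c_def using m' dm r by (intro closed_contains_Sup cl) (auto intro!: exI[of _ m] bdd_aboveI[of _ L])
  have cl: "d x < r" if "c < x" "x \<le> L" for x
  proof (rule ccontr)
    assume "\<not> d x < r"
    then have "x \<le> c" unfolding c_def using that c by (intro cSup_upper) (auto intro!: bdd_aboveI[of _ L])
    then show False using that by simp
  qed
  have b0: "0 < b" using b ends r by (auto simp: less_le)
  have cL: "c < L" using c ends r by (auto simp: less_le)
  have db: "d b = r"
  proof (rule ccontr)
    assume "d b \<noteq> r"
    then have "r < d b" using b by auto
    then obtain x where "0 \<le> x" "x \<le> b" "d x = r" using IVT'[of d 0 r b] ends r b0 cd by auto
    then show False using bl[of x] \<open>d b \<noteq> r\<close> by (auto simp: less_le)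
  qed
  have dc: "d c = r"
  proof (rule ccontr)
    assume "d c \<noteq> r"
    then have "r < d c" using c by auto
    then obtain x where "c \<le> x" "x \<le> L" "d x = r" using IVT2'[of d L r c] ends r cL cd by auto
    then show False using cl[of x] \<open>d c \<noteq> r\<close> by (auto simp: less_le)
  qed
  have bm: "b < m" "m < c" using b c db dc dm r by (auto simp: less_le)
  have leb: "d x \<le> r" if "0 \<le> x" "x \<le> b" for x using bl[of x] db that by (cases "x = b") auto
  have lec: "d x \<le> r" if "c \<le> x" "x \<le> L" for x using cl[of x] dc that by (cases "x = c") auto
  have mb: "strict_mono_on {0..b} d"
  proof -
    have "inj_on d {0..b}"
      by (rule linorder_inj_onI') (use no_crit leb r bm m' in \<open>smt (verit) atLeastAtMost_iff\<close>)
    then consider "strict_mono_on {0..b} d" | "strict_antimono_on {0..b} d"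
      using injective_eq_monotone_map[of "{0..b}" d] cd by auto
    then show ?thesis
    proof cases
      case 2
      then have "d b < d 0" using b0 by (auto simp: monotone_on_def)
      then show ?thesis using db ends r by simp
    qed
  qed
  have mc: "strict_antimono_on {c..L} d"
  proof -
    have "inj_on d {c..L}"
      by (rule linorder_inj_onI') (use no_crit lec r bm m' in \<open>smt (verit) atLeastAtMost_iff\<close>)
    then consider "strict_mono_on {c..L} d" | "strict_antimono_on {c..L} d"
      using injective_eq_monotone_map[of "{c..L}" d] cd by auto
    then show ?thesis
    proof cases
      case 1
      then have "d c < d L" using cL by (auto simp: monotone_on_def)
      then show ?thesis using dc ends r by simp
    qed
  qed
  have mid: "r < d x" if x: "b < x" "x < c" for x
  proof (rule ccontr)
    assume "\<not> r < d x"
    obtain y where y: "y \<in> {b..c}" "\<And>x. x \<in> {b..c} \<Longrightarrow> d y \<le> d x"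
      using continuous_attains_inf[of "{b..c}" d] cd x by auto
    \<comment> \<open>If the minimum is attained at an end, its value is \<open>r\<close>, and then
      \<open>x\<close>, of height at most \<open>r\<close>, is an interior minimum.\<close>
    obtain z where z: "b < z" "z < c" "\<And>x. x \<in> {b..c} \<Longrightarrow> d z \<le> d x"
    proof (cases "y = b \<or> y = c")
      case True
      then have "d y = r" using db dc by auto
      then show ?thesis using that[of x] x y(2) \<open>\<not> r < d x\<close> by force
    next
      case False then show ?thesis using that[of y] y by (auto simp: less_le)
    qed
    have "d' z = 0"
      by (rule DERIV_local_min[OF d, of "min (z - b) (c - z)"]) (use z in \<open>auto simp: abs_if split: if_splits\<close>)
    moreover have "d z \<le> R" using z(3)[of b] db r bm by auto
    ultimately show False using reg[of z] z b0 cL by auto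
  qed
  show thesis using that[of b c] b0 bm cL db dc mb mc mid by auto
qed

section \<open>Consequences of the graph condition\<close>

context periodic_unit_speed
begin

text \<open>The form in which the graph condition enters the later arguments. It concludes with
  equality of points because parameters are determined only modulo \<open>L\<close>.\<close>

definition transversal :: "real \<Rightarrow> bool" where
  "transversal R \<longleftrightarrow> (\<forall>s t. cmod (\<gamma> s - \<gamma> t) \<le> R \<longrightarrow> (\<gamma> s - \<gamma> t) \<bullet> T t = 0 \<longrightarrow> \<gamma> s = \<gamma> t)"

text \<open>Near \<open>t\<close> the ordinate of the curve is \<open>f\<close> of its abscissa, and
  \<open>f\<close> has derivative 0 at 0, so \<open>T t\<close> has no \<open>e2\<close> component.
  A chord orthogonal to \<open>T t\<close> then has abscissa 0, hence ordinate
  \<open>f 0 = 0\<close>.\<close>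

lemma TGL_imp_transversal:
  assumes "TGL (range \<gamma>) R" and R: "0 < R"
  shows "transversal R"
  unfolding transversal_def
proof (intro allI impI)
  fix s t
  assume st: "cmod (\<gamma> s - \<gamma> t) \<le> R" and orth: "(\<gamma> s - \<gamma> t) \<bullet> T t = 0"
  have "TGL_at (range \<gamma>) (\<gamma> t) R" using assms by (auto simp: TGL_def)
  then obtain e1 e2 A f where e: "norm e1 = 1" "norm e2 = 1" "e1 \<bullet> e2 = 0" and f: "f 0 = 0" "(f has_real_derivative 0) (at 0)"
    and gr: "range \<gamma> \<inter> cball (\<gamma> t) R = (\<lambda>x. \<gamma> t + x *\<^sub>R e1 + f x *\<^sub>R e2) ` A"
    unfolding TGL_at_def by blast
  have e11: "e1 \<bullet> e1 = 1" "e2 \<bullet> e2 = 1" using e by (auto simp: dot_square_norm)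
  have graph: "(\<gamma> x - \<gamma> t) \<bullet> e2 = f ((\<gamma> x - \<gamma> t) \<bullet> e1)" "\<gamma> x = \<gamma> t + ((\<gamma> x - \<gamma> t) \<bullet> e1) *\<^sub>R e1 + f ((\<gamma> x - \<gamma> t) \<bullet> e1) *\<^sub>R e2"
    if "cmod (\<gamma> x - \<gamma> t) \<le> R" for x
  proof -
    have "\<gamma> x \<in> range \<gamma> \<inter> cball (\<gamma> t) R" using that by (auto simp: dist_norm norm_minus_commute)
    then obtain u where u: "\<gamma> x = \<gamma> t + u *\<^sub>R e1 + f u *\<^sub>R e2" using gr by auto
    then have "(\<gamma> x - \<gamma> t) \<bullet> e1 = u" "(\<gamma> x - \<gamma> t) \<bullet> e2 = f u"
      using e e11 by (auto simp: inner_add_left inner_commute[of e2 e1])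
    then show "(\<gamma> x - \<gamma> t) \<bullet> e2 = f ((\<gamma> x - \<gamma> t) \<bullet> e1)" "\<gamma> x = \<gamma> t + ((\<gamma> x - \<gamma> t) \<bullet> e1) *\<^sub>R e1 + f ((\<gamma> x - \<gamma> t) \<bullet> e1) *\<^sub>R e2"
      using u by auto
  qed
  define X where "X x = (\<gamma> x - \<gamma> t) \<bullet> e1" for x
  have dX: "(X has_real_derivative T t \<bullet> e1) (at t)"
    unfolding X_def has_real_derivative_iff_has_vector_derivative
    by (rule bounded_linear.has_vector_derivative[OF bounded_linear_inner_left])
       (use has_vector_derivative_diff[OF deriv has_vector_derivative_const] in simp)
  have dY: "((\<lambda>x. (\<gamma> x - \<gamma> t) \<bullet> e2) has_real_derivative T t \<bullet> e2) (at t)"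
    unfolding has_real_derivative_iff_has_vector_derivative
    by (rule bounded_linear.has_vector_derivative[OF bounded_linear_inner_left])
       (use has_vector_derivative_diff[OF deriv has_vector_derivative_const] in simp)
  have X0: "X t = 0" by (simp add: X_def)
  have "((\<lambda>x. f (X x)) has_real_derivative 0 * (T t \<bullet> e1)) (at t)"
    using f(2) X0 by (intro DERIV_chain2[OF _ dX]) simp
  moreover have "open {x. cmod (\<gamma> x - \<gamma> t) < R}"
    by (intro open_Collect_less continuous_intros cont)
  ultimately have "((\<lambda>x. (\<gamma> x - \<gamma> t) \<bullet> e2) has_real_derivative 0 * (T t \<bullet> e1)) (at t)"
    by (rule has_field_derivative_transform_within_open) (use R graph(1) in \<open>auto simp: X_def less_imp_le\<close>)
  then have Te2: "T t \<bullet> e2 = 0" using DERIV_unique[OF dY] by simp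
  define u where "u = X s"
  have gs: "\<gamma> s - \<gamma> t = u *\<^sub>R e1 + f u *\<^sub>R e2" using graph(2)[OF st] unfolding u_def X_def by (metis add.assoc add_diff_cancel_left')
  have "u * (e1 \<bullet> T t) = 0" using orth Te2 unfolding gs by (simp add: inner_add_left inner_commute[of "T t" e2])
  have "e1 \<bullet> T t \<noteq> 0"
  proof
    assume h: "e1 \<bullet> T t = 0"
    have a: "Re e1 * Re (T t) + Im e1 * Im (T t) = 0" "Re e2 * Re (T t) + Im e2 * Im (T t) = 0" "Re e1 * Re e2 + Im e1 * Im e2 = 0"
      "Re e1 * Re e1 + Im e1 * Im e1 = 1" "Re e2 * Re e2 + Im e2 * Im e2 = 1"
      using h Te2 e(3) e11 by (auto simp: inner_complex_def mult.commute)
    have "Re (T t) = 0 \<and> Im (T t) = 0" using a by algebra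
    then have "T t = 0" by (simp add: complex_eq_iff)
    then show False using norm_T[of t] by simp
  qed
  then have "u = 0" using \<open>u * (e1 \<bullet> T t) = 0\<close> by simp
  then show "\<gamma> s = \<gamma> t" using gs f(1) by simp
qed

lemma chord_deriv:
  "((\<lambda>x. (cmod (\<gamma> (s + x) - \<gamma> s))\<^sup>2) has_real_derivative 2 * ((\<gamma> (s + x) - \<gamma> s) \<bullet> T (s + x))) (at x)"
proof -
  have A: "((\<lambda>x. \<gamma> (s + x) - \<gamma> s) has_derivative (\<lambda>h. h *\<^sub>R T (s + x))) (at x)"
    using has_vector_derivative_diff[OF has_vector_derivative_shift[of s x UNIV] has_vector_derivative_const, of "\<gamma> s"]
    by (simp add: has_vector_derivative_def)
  have eq: "(\<lambda>h. (\<gamma> (s + x) - \<gamma> s) \<bullet> (h *\<^sub>R T (s + x)) + (h *\<^sub>R T (s + x)) \<bullet> (\<gamma> (s + x) - \<gamma> s))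
      = (*) (2 * ((\<gamma> (s + x) - \<gamma> s) \<bullet> T (s + x)))"
    by (simp add: fun_eq_iff inner_commute)
  show ?thesis
    using has_derivative_inner[OF A A] unfolding eq
    by (simp add: has_field_derivative_def power2_norm_eq_inner)
qed

end

locale tgl_loop = periodic_unit_speed +
  fixes R :: real
  assumes R_pos: "0 < R" and trans: "transversal R"
begin

lemma chord_regular:
  assumes "\<bar>s - t\<bar> < L" "s \<noteq> t" "cmod (\<gamma> s - \<gamma> t) \<le> R"
  shows "(\<gamma> s - \<gamma> t) \<bullet> T t \<noteq> 0"
  using assms trans inj unfolding transversal_def by blast

text \<open>\<open>two_crossings\<close> is applied to the squared chord length, which is
  differentiable also at offset 0, with heights \<open>r\<^sup>2\<close> and
  \<open>R\<^sup>2\<close>. A critical offset would give a chord orthogonal to the tangent at its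
  far end, against \<open>chord_regular\<close>.\<close>

lemma exists_two_arc:
  assumes r: "0 < r" "r \<le> R"
  obtains b c where "two_arc s r b c"
    "strict_mono_on {0..b} (\<lambda>x. cmod (\<gamma> (s + x) - \<gamma> s))" "strict_antimono_on {c..L} (\<lambda>x. cmod (\<gamma> (s + x) - \<gamma> s))"
proof -
  define d where "d x = (cmod (\<gamma> (s + x) - \<gamma> s))\<^sup>2" for x
  define d' where "d' x = 2 * ((\<gamma> (s + x) - \<gamma> s) \<bullet> T (s + x))" for x
  have dd: "(d has_real_derivative d' x) (at x)" for x
    unfolding d_def d'_def by (rule chord_deriv)
  have sq: "d x < \<rho>\<^sup>2 \<longleftrightarrow> cmod (\<gamma> (s + x) - \<gamma> s) < \<rho>" "\<rho>\<^sup>2 < d x \<longleftrightarrow> \<rho> < cmod (\<gamma> (s + x) - \<gamma> s)"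
     "d x = \<rho>\<^sup>2 \<longleftrightarrow> cmod (\<gamma> (s + x) - \<gamma> s) = \<rho>" if "0 < \<rho>" for x \<rho>
    using that by (auto simp: d_def power_mono_iff power2_eq_iff_nonneg abs_le_square_iff[symmetric] simp flip: not_le)
  have mon: "d x < d y \<longleftrightarrow> cmod (\<gamma> (s + x) - \<gamma> s) < cmod (\<gamma> (s + y) - \<gamma> s)" for x y
    by (auto simp: d_def abs_le_square_iff[symmetric] simp flip: not_le)
  have reg: "d' x \<noteq> 0" if "0 < x" "x < L" "d x \<le> R\<^sup>2" for x
  proof -
    have le: "cmod (\<gamma> (s + x) - \<gamma> s) \<le> R" using sq(2)[OF R_pos, of x] that(3) by linarith
    show ?thesis
    proof
      assume "d' x = 0"
      then have "(\<gamma> s - \<gamma> (s + x)) \<bullet> T (s + x) = 0" by (simp add: d'_def inner_diff_left)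
      then show False using chord_regular[of s "s + x"] that le by (simp add: norm_minus_commute)
    qed
  qed
  have pos: "0 < d x" if "0 < x" "x < L" for x
    using inj[of "s + x" s] that by (auto simp: d_def)
  have ends: "d 0 = 0" "d L = 0" using per[of s] by (auto simp: d_def)
  have rR: "0 < r\<^sup>2" "r\<^sup>2 \<le> R\<^sup>2" using r by (auto intro: power_mono)
  obtain b c where bc: "0 < b" "b < c" "c < L" "d b = r\<^sup>2" "d c = r\<^sup>2"
    "strict_mono_on {0..b} d" "strict_antimono_on {c..L} d" "\<And>x. b < x \<Longrightarrow> x < c \<Longrightarrow> r\<^sup>2 < d x"
    using two_crossings[OF L_pos dd ends pos reg rR] by blast
  have "d x < r\<^sup>2" if "0 \<le> x" "x < b" for x
    using strict_mono_onD[OF bc(6), of x b] that bc by auto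
  moreover have "d x < r\<^sup>2" if "c < x" "x \<le> L" for x
    using monotone_onD[OF bc(7), of c x] that bc by auto
  ultimately have "two_arc s r b c"
    unfolding two_arc_def using bc sq r by auto
  then show thesis
    using that bc(6,7) mon unfolding monotone_on_def by auto
qed

end

context periodic_unit_speed
begin

text \<open>If two exit offsets differed, the smaller one would have distance \<open>r\<close> by
  one description and less than \<open>r\<close> by the other; for the re-entry offsets the larger
  one is contradictory in the same way.\<close>

lemma two_arc_unique:
  assumes "two_arc s r b c" "two_arc s r b' c'"
  shows "b = b'" "c = c'"
proof -
  have "\<not> b < b'" if "two_arc s r b c" "two_arc s r b' c'" for b c b' c'
    using that unfolding two_arc_def by force
  then show "b = b'" using assms by (meson linorder_neqE_linordered_idom)
  have "\<not> c < c'" if "two_arc s r b c" "two_arc s r b' c'" for b c b' c'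
    using that unfolding two_arc_def by (metis (no_types, lifting) UnI2 greaterThanAtMost_iff less_imp_le less_irrefl)
  then show "c = c'" using assms by (meson linorder_neqE_linordered_idom)
qed

lemma two_arc_shift: "two_arc (s + of_int n * L) r b c \<longleftrightarrow> two_arc s r b c"
proof -
  have "\<gamma> (s + of_int n * L + x) = \<gamma> (s + x)" for x using per_int[of "s + x" n] by (simp add: add_ac)
  then show ?thesis by (simp add: two_arc_def per_int)
qed

text \<open>Uniqueness makes the choice unambiguous wherever \<open>two_arc\<close> holds for some
  pair. \<open>bwd\<close> is still measured forwards, so the backward arc has length
  \<open>L - bwd s r\<close>.\<close>

definition fwd :: "real \<Rightarrow> real \<Rightarrow> real" where "fwd s r = (SOME b. \<exists>c. two_arc s r b c)"
definition bwd :: "real \<Rightarrow> real \<Rightarrow> real" where "bwd s r = (SOME c. \<exists>b. two_arc s r b c)"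

lemma fwd_bwd_eq: "two_arc s r b c \<Longrightarrow> fwd s r = b \<and> bwd s r = c"
  unfolding fwd_def bwd_def using two_arc_unique by (metis (mono_tags, lifting) someI_ex)

end

context tgl_loop
begin

lemma two_arc_fwd_bwd: "0 < r \<Longrightarrow> r \<le> R \<Longrightarrow> two_arc s r (fwd s r) (bwd s r)"
  using exists_two_arc fwd_bwd_eq by metis

lemma mono_fwd: "0 < r \<Longrightarrow> r \<le> R \<Longrightarrow> strict_mono_on {0..fwd s r} (\<lambda>x. cmod (\<gamma> (s + x) - \<gamma> s))"
  using exists_two_arc fwd_bwd_eq by metis

lemma antimono_bwd: "0 < r \<Longrightarrow> r \<le> R \<Longrightarrow> strict_antimono_on {bwd s r..L} (\<lambda>x. cmod (\<gamma> (s + x) - \<gamma> s))"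
  using exists_two_arc fwd_bwd_eq by metis

lemma arc_le:
  assumes "0 < r" "r \<le> R" "0 \<le> x" "x \<le> L"
  shows "cmod (\<gamma> (s + x) - \<gamma> s) \<le> r \<longleftrightarrow> x \<le> fwd s r \<or> bwd s r \<le> x"
proof -
  have "\<And>x. 0 \<le> x \<Longrightarrow> x < fwd s r \<Longrightarrow> cmod (\<gamma> (s + x) - \<gamma> s) < r"
    "\<And>x. bwd s r < x \<Longrightarrow> x \<le> L \<Longrightarrow> cmod (\<gamma> (s + x) - \<gamma> s) < r"
    "\<And>x. fwd s r < x \<Longrightarrow> x < bwd s r \<Longrightarrow> r < cmod (\<gamma> (s + x) - \<gamma> s)"
    "cmod (\<gamma> (s + fwd s r) - \<gamma> s) = r" "cmod (\<gamma> (s + bwd s r) - \<gamma> s) = r" "fwd s r < bwd s r"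
    using two_arc_fwd_bwd[OF assms(1,2), of s] by (auto simp: two_arc_def)
  from this(1-3)[of x] this(4-6) show ?thesis
    using assms(3,4)
    by (cases "x < fwd s r"; cases "x = fwd s r"; cases "x = bwd s r"; cases "bwd s r < x") auto
qed

lemma arc_bounds:
  assumes "0 < r" "r \<le> R"
  shows "0 < fwd s r" "fwd s r < bwd s r" "bwd s r < L"
    "cmod (\<gamma> (s + fwd s r) - \<gamma> s) = r" "cmod (\<gamma> (s + bwd s r) - \<gamma> s) = r"
  using two_arc_fwd_bwd[OF assms, of s] by (auto simp: two_arc_def)

lemma deriv_inner: "((\<lambda>x. (\<gamma> (s + x) - \<gamma> s) \<bullet> v) has_real_derivative T (s + x) \<bullet> v) (at x)"
  unfolding has_real_derivative_iff_has_vector_derivative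
  by (rule bounded_linear.has_vector_derivative[OF bounded_linear_inner_left])
     (use has_vector_derivative_diff[OF has_vector_derivative_shift has_vector_derivative_const] in simp)

text \<open>The tangential component starts at 0 with slope \<open>T s \<bullet> T s = 1\<close>. A
  later nonpositive value would force a zero on the forward arc: a chord of length at most
  \<open>R\<close> orthogonal to \<open>T s\<close>.\<close>

lemma fwd_tangent_pos:
  assumes r: "0 < r" "r \<le> R" and x: "0 < x" "x \<le> fwd s r"
  shows "0 < (\<gamma> (s + x) - \<gamma> s) \<bullet> T s"
proof (rule ccontr)
  define q where "q x = (\<gamma> (s + x) - \<gamma> s) \<bullet> T s" for x
  assume "\<not> 0 < (\<gamma> (s + x) - \<gamma> s) \<bullet> T s"
  then have qx: "q x \<le> 0" by (simp add: q_def)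
  have dq: "(q has_real_derivative T (s + y) \<bullet> T s) (at y)" for y
    unfolding q_def by (rule deriv_inner)
  have cq: "continuous_on A q" for A using dq DERIV_isCont by (blast intro: continuous_at_imp_continuous_on)
  have "0 < T (s + 0) \<bullet> T s" using norm_T[of s] by (simp add: dot_square_norm)
  from DERIV_pos_inc_right[OF dq this] obtain e where e: "0 < e" "\<And>h. 0 < h \<Longrightarrow> h < e \<Longrightarrow> q 0 < q (0 + h)"
    by blast
  define h where "h = min (e / 2) x"
  have h: "0 < h" "h < e" "h \<le> x" using e x by (auto simp: h_def)
  have "0 < q h" using e(2)[OF h(1,2)] by (simp add: q_def)
  then obtain y where y: "h \<le> y" "y \<le> x" "q y = 0" using IVT2'[of q x 0 h] qx h cq by auto
  have "cmod (\<gamma> (s + y) - \<gamma> s) \<le> r" using arc_le[OF r, of y s] y x h arc_bounds[OF r, of s] by auto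
  then show False
    using chord_regular[of "s + y" s] y h x r arc_bounds[OF r, of s] by (auto simp: q_def)
qed

text \<open>The same argument from the other end: at offset \<open>L\<close> the component is 0 with
  slope 1, so it is negative just before.\<close>

lemma bwd_tangent_neg:
  assumes r: "0 < r" "r \<le> R" and x: "bwd s r \<le> x" "x < L"
  shows "(\<gamma> (s + x) - \<gamma> s) \<bullet> T s < 0"
proof (rule ccontr)
  define q where "q x = (\<gamma> (s + x) - \<gamma> s) \<bullet> T s" for x
  assume "\<not> (\<gamma> (s + x) - \<gamma> s) \<bullet> T s < 0"
  then have qx: "0 \<le> q x" by (simp add: q_def)
  have dq: "(q has_real_derivative T (s + y) \<bullet> T s) (at y)" for y
    unfolding q_def by (rule deriv_inner)
  have cq: "continuous_on A q" for A using dq DERIV_isCont by (blast intro: continuous_at_imp_continuous_on)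
  have "0 < T (s + L) \<bullet> T s" using norm_T[of s] per_T[of s] by (simp add: dot_square_norm)
  from DERIV_pos_inc_left[OF dq this] obtain e where e: "0 < e" "\<And>h. 0 < h \<Longrightarrow> h < e \<Longrightarrow> q (L - h) < q L"
    by blast
  define h where "h = min (e / 2) (L - x)"
  have h: "0 < h" "h < e" "x \<le> L - h" using e x by (auto simp: h_def)
  have "q (L - h) < 0" using e(2)[OF h(1,2)] per[of s] by (simp add: q_def)
  then obtain y where y: "x \<le> y" "y \<le> L - h" "q y = 0" using IVT2'[of q "L - h" 0 x] qx h cq by auto
  have y0: "0 < y" using y x arc_bounds[OF r, of s] by auto
  have "cmod (\<gamma> (s + y) - \<gamma> s) \<le> r" using arc_le[OF r, of y s] y0 y x h by auto
  then show False
    using chord_regular[of "s + y" s] y y0 h x r by (auto simp: q_def)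
qed

text \<open>This concerns the tangent at the far end: the distance increases along the forward arc,
  so its square has no negative derivative, and the derivative is nonzero by
  \<open>chord_regular\<close>.\<close>

lemma fwd_tangent_pos':
  assumes r: "0 < r" "r \<le> R" and x: "0 < x" "x \<le> fwd s r"
  shows "0 < (\<gamma> (s + x) - \<gamma> s) \<bullet> T (s + x)"
proof (rule ccontr)
  assume n: "\<not> 0 < (\<gamma> (s + x) - \<gamma> s) \<bullet> T (s + x)"
  have xL: "x < L" using x arc_bounds[OF r, of s] by auto
  have "cmod (\<gamma> (s + x) - \<gamma> s) \<le> R" using arc_le[OF r, of x s] x xL r by auto
  then have "(\<gamma> s - \<gamma> (s + x)) \<bullet> T (s + x) \<noteq> 0"
    using chord_regular[of s "s + x"] x xL by (simp add: norm_minus_commute)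
  then have "2 * ((\<gamma> (s + x) - \<gamma> s) \<bullet> T (s + x)) < 0" using n by (simp add: inner_diff_left)
  from DERIV_neg_dec_left[OF chord_deriv this] obtain e where e: "0 < e"
    "\<And>h. 0 < h \<Longrightarrow> h < e \<Longrightarrow> (cmod (\<gamma> (s + x) - \<gamma> s))\<^sup>2 < (cmod (\<gamma> (s + (x - h)) - \<gamma> s))\<^sup>2" by blast
  define h where "h = min (e / 2) x"
  have h: "0 < h" "h < e" "h \<le> x" using e x by (auto simp: h_def)
  have "cmod (\<gamma> (s + (x - h)) - \<gamma> s) < cmod (\<gamma> (s + x) - \<gamma> s)"
    using strict_mono_onD[OF mono_fwd[OF r, of s], of "x - h" x] h x by auto
  then have "(cmod (\<gamma> (s + (x - h)) - \<gamma> s))\<^sup>2 \<le> (cmod (\<gamma> (s + x) - \<gamma> s))\<^sup>2" by (intro power_mono) auto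
  then show False using e(2)[OF h(1,2)] by linarith
qed

lemma bwd_tangent_neg':
  assumes r: "0 < r" "r \<le> R" and x: "bwd s r \<le> x" "x < L"
  shows "(\<gamma> (s + x) - \<gamma> s) \<bullet> T (s + x) < 0"
proof (rule ccontr)
  assume n: "\<not> (\<gamma> (s + x) - \<gamma> s) \<bullet> T (s + x) < 0"
  have x0: "0 < x" using x arc_bounds[OF r, of s] by auto
  have "cmod (\<gamma> (s + x) - \<gamma> s) \<le> R" using arc_le[OF r, of x s] x x0 r by auto
  then have "(\<gamma> s - \<gamma> (s + x)) \<bullet> T (s + x) \<noteq> 0"
    using chord_regular[of s "s + x"] x x0 by (simp add: norm_minus_commute)
  then have "0 < 2 * ((\<gamma> (s + x) - \<gamma> s) \<bullet> T (s + x))" using n by (simp add: inner_diff_left)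
  from DERIV_pos_inc_right[OF chord_deriv this] obtain e where e: "0 < e"
    "\<And>h. 0 < h \<Longrightarrow> h < e \<Longrightarrow> (cmod (\<gamma> (s + x) - \<gamma> s))\<^sup>2 < (cmod (\<gamma> (s + (x + h)) - \<gamma> s))\<^sup>2" by blast
  define h where "h = min (e / 2) (L - x)"
  have h: "0 < h" "h < e" "x + h \<le> L" using e x by (auto simp: h_def)
  have "cmod (\<gamma> (s + (x + h)) - \<gamma> s) < cmod (\<gamma> (s + x) - \<gamma> s)"
    using monotone_onD[OF antimono_bwd[OF r, of s], of x "x + h"] h x by auto
  then have "(cmod (\<gamma> (s + (x + h)) - \<gamma> s))\<^sup>2 \<le> (cmod (\<gamma> (s + x) - \<gamma> s))\<^sup>2" by (intro power_mono) auto
  then show False using e(2)[OF h(1,2)] by linarith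
qed

section \<open>The exit maps\<close>

text \<open>Absolute parameters at which the curve, followed forwards or backwards from
  \<open>s\<close>, first reaches the circle of radius \<open>R\<close>. Subtracting
  \<open>L\<close> moves the re-entry offset to the period before \<open>s\<close>.\<close>

definition next_exit :: "real \<Rightarrow> real" where "next_exit s = s + fwd s R"
definition prev_exit :: "real \<Rightarrow> real" where "prev_exit s = s - L + bwd s R"

text \<open>The chord has the same sign against both tangents, and this sign tells the forward arc
  from the backward one. It is information that both ends of the chord share, which
  \<open>exit_galois\<close> exploits.\<close>

lemma chord_dichotomy:
  assumes "s < t" "t < s + L" "cmod (\<gamma> t - \<gamma> s) \<le> R"
  shows "t \<le> next_exit s \<and> 0 < (\<gamma> t - \<gamma> s) \<bullet> T s \<and> 0 < (\<gamma> t - \<gamma> s) \<bullet> T t \<or>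
     s + bwd s R \<le> t \<and> (\<gamma> t - \<gamma> s) \<bullet> T s < 0 \<and> (\<gamma> t - \<gamma> s) \<bullet> T t < 0"
proof -
  have "t - s \<le> fwd s R \<or> bwd s R \<le> t - s"
    using arc_le[OF R_pos order_refl, of "t - s" s] assms by simp
  then show ?thesis
    using fwd_tangent_pos[OF R_pos order_refl, of "t - s" s] fwd_tangent_pos'[OF R_pos order_refl, of "t - s" s]
      bwd_tangent_neg[OF R_pos order_refl, of s "t - s"] bwd_tangent_neg'[OF R_pos order_refl, of s "t - s"] assms
    by (auto simp: next_exit_def algebra_simps)
qed

text \<open>The chord from \<open>t\<close> back to \<open>s\<close> is also the chord from \<open>t\<close> to \<open>s + L\<close>, so the dichotomy applies at
  both ends, and the sign of the tangential component decides which case holds.\<close>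

lemma exit_galois:
  assumes "s < t" "t < s + L" "cmod (\<gamma> t - \<gamma> s) \<le> R"
  shows "t \<le> next_exit s \<longleftrightarrow> prev_exit t \<le> s"
proof -
  have flip: "(\<gamma> s - \<gamma> t) \<bullet> v = - ((\<gamma> t - \<gamma> s) \<bullet> v)" for v by (simp add: inner_diff_left)
  have 1: "s + L \<le> next_exit t \<and> (\<gamma> t - \<gamma> s) \<bullet> T t < 0 \<and> (\<gamma> t - \<gamma> s) \<bullet> T s < 0 \<or>
     t + bwd t R \<le> s + L \<and> 0 < (\<gamma> t - \<gamma> s) \<bullet> T t \<and> 0 < (\<gamma> t - \<gamma> s) \<bullet> T s"
    using chord_dichotomy[of t "s + L"] assms by (simp add: per per_T norm_minus_commute flip)
  have 2: "next_exit t < t + bwd t R" "next_exit s < s + bwd s R"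
    using arc_bounds[OF R_pos order_refl] by (auto simp: next_exit_def)
  show ?thesis
    using 1 2 chord_dichotomy[OF assms] by (auto simp: prev_exit_def)
qed

lemma exit_bounds: "s < next_exit s" "next_exit s < s + L" "prev_exit s < s" "s - L < prev_exit s"
  "cmod (\<gamma> (next_exit s) - \<gamma> s) = R" "cmod (\<gamma> (prev_exit s) - \<gamma> s) = R"
proof -
  note a = arc_bounds[OF R_pos order_refl, of s]
  show "s < next_exit s" "next_exit s < s + L" "prev_exit s < s" "s - L < prev_exit s"
    "cmod (\<gamma> (next_exit s) - \<gamma> s) = R"
    using a by (auto simp: next_exit_def prev_exit_def)
  show "cmod (\<gamma> (prev_exit s) - \<gamma> s) = R"
    using a(5) per[of "prev_exit s"] by (simp add: prev_exit_def)
qed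

lemma chord_lt_next: "s < t \<Longrightarrow> t < next_exit s \<Longrightarrow> cmod (\<gamma> t - \<gamma> s) < R"
  using two_arc_fwd_bwd[OF R_pos order_refl, of s] unfolding two_arc_def next_exit_def
  by (auto dest!: bspec[of _ _ "t - s"])

lemma chord_lt_prev: "prev_exit t < s \<Longrightarrow> s < t \<Longrightarrow> cmod (\<gamma> t - \<gamma> s) < R"
  using two_arc_fwd_bwd[OF R_pos order_refl, of t] per[of s] unfolding two_arc_def prev_exit_def
  by (auto dest!: bspec[of _ _ "s + L - t"] simp: norm_minus_commute)

text \<open>\<open>exit_galois\<close> gives \<open>t \<le> next_exit (prev_exit t)\<close>;
  strictly before that exit the chord would be shorter than \<open>R\<close>, but it has length
  \<open>R\<close>.\<close>

lemma next_prev: "next_exit (prev_exit t) = t"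
proof -
  let ?s = "prev_exit t"
  have "cmod (\<gamma> t - \<gamma> ?s) = R" using exit_bounds(6)[of t] by (simp add: norm_minus_commute)
  then show ?thesis
    using exit_galois[of ?s t] exit_bounds[of t] chord_lt_next[of ?s t] by force
qed

text \<open>Let \<open>t\<close> be the exit of \<open>s\<close>, beyond \<open>s'\<close>. Then
  \<open>s'\<close> lies between \<open>prev_exit t\<close> and \<open>t\<close>, so its chord to
  \<open>t\<close> is shorter than \<open>R\<close>. By \<open>exit_galois\<close>, \<open>t\<close>
  comes no later than the exit of \<open>s'\<close>, and not at it, since the chord there has length
  \<open>R\<close>.\<close>

lemma strict_mono_next: "strict_mono next_exit"
proof (rule strict_monoI)
  fix s s' :: real assume ss: "s < s'"
  show "next_exit s < next_exit s'"
  proof (cases "next_exit s \<le> s'")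
    case True then show ?thesis using exit_bounds(1)[of s'] by simp
  next
    case False
    let ?t = "next_exit s"
    have "prev_exit ?t \<le> s" using exit_galois[of s ?t] exit_bounds[of s] by simp
    then have lt: "cmod (\<gamma> ?t - \<gamma> s') < R" using chord_lt_prev[of ?t s'] ss False by simp
    then have "?t \<le> next_exit s'"
      using exit_galois[of s' ?t] \<open>prev_exit ?t \<le> s\<close> ss False exit_bounds[of s] by simp
    moreover have "?t \<noteq> next_exit s'" using lt exit_bounds(5)[of s'] by auto
    ultimately show ?thesis by simp
  qed
qed

text \<open>A chord of length \<open>R\<close> needs arclength at least \<open>R\<close>; this
  uniform gain makes finitely many slides suffice.\<close>

lemma next_exit_ge: "s + R \<le> next_exit s"
  using gamma_Lipschitz[of "next_exit s" s] exit_bounds[of s] by simp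

end

section \<open>Reconstruction\<close>

text \<open>The real axis plays the tangent. The differences are the same multiple \<open>p\<close>
  of \<open>u1\<close> and \<open>v1\<close>, so they have equal moduli; with equal imaginary parts
  and negative real parts they coincide. As \<open>p\<close> is nonzero,
  \<open>u1 = v1\<close>.\<close>

lemma unit_pair_determined:
  fixes u1 u2 v1 v2 :: complex
  assumes n: "cmod u1 = 1" "cmod v1 = 1"
    and re: "0 < Re u1" "Re u2 < 0" "0 < Re v1" "Re v2 < 0"
    and q: "u2 / u1 = v2 / v1" and im: "Im (u2 - u1) = Im (v2 - v1)"
  shows "u1 = v1"
proof -
  define p where "p = u2 / u1 - 1"
  have nz: "u1 \<noteq> 0" "v1 \<noteq> 0" using n by auto
  have a: "u2 - u1 = p * u1" "v2 - v1 = p * v1" using nz q by (auto simp: p_def field_simps)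
  have "cmod (u2 - u1) = cmod (v2 - v1)" unfolding a using n by (simp add: norm_mult)
  then have "(Re (u2 - u1))\<^sup>2 = (Re (v2 - v1))\<^sup>2"
    using im by (simp add: cmod_def)
  moreover have "Re (u2 - u1) < 0" "Re (v2 - v1) < 0" using re by auto
  ultimately have "Re (u2 - u1) = Re (v2 - v1)"
    by (metis less_asym neg_0_less_iff_less power2_eq_iff)
  with im have "u2 - u1 = v2 - v1" by (simp add: complex_eq_iff)
  then have "p * u1 = p * v1" using a by simp
  moreover have "p \<noteq> 0" using a re by auto
  ultimately show ?thesis by simp
qed

text \<open>No differentiability of \<open>\<phi>\<close> is assumed. Chord length over parameter
  difference tends to 1 for both \<open>f\<close> and \<open>g\<close>, and the chords are the same,
  so the quotient of the two limits shows that \<open>\<phi>\<close> has derivative 1.\<close>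

lemma reparametrization_rigid:
  fixes f g :: "real \<Rightarrow> complex" and \<phi> :: "real \<Rightarrow> real"
  assumes f: "\<And>x. (f has_vector_derivative f' x) (at x)" "\<And>x. cmod (f' x) = 1"
    and g: "\<And>x. (g has_vector_derivative g' x) (at x)" "\<And>x. cmod (g' x) = 1"
    and \<phi>: "continuous_on {a..b} \<phi>" "strict_mono_on {a..b} \<phi>"
    and eq: "\<And>x. x \<in> {a..b} \<Longrightarrow> f x = g (\<phi> x)"
    and x: "x \<in> {a..b}"
  shows "\<phi> x = x + (\<phi> a - a)"
proof -
  have quot: "((\<lambda>y. cmod (h y - h x) / \<bar>y - x\<bar>) \<longlongrightarrow> 1) (at x)"
    if "(h has_vector_derivative d) (at x)" "cmod d = 1" for h :: "real \<Rightarrow> complex" and d x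
  proof -
    have lim: "((\<lambda>y. cmod (h y - h x - (y - x) *\<^sub>R d) / norm (y - x)) \<longlongrightarrow> 0) (at x)"
      using that(1) by (simp add: has_vector_derivative_def has_derivative_iff_norm)
    have "((\<lambda>y. cmod (h y - h x) / \<bar>y - x\<bar> - 1) \<longlongrightarrow> 0) (at x)"
    proof (rule Lim_null_comparison[OF _ lim])
      have "norm (cmod (h y - h x) / \<bar>y - x\<bar> - 1) \<le> cmod (h y - h x - (y - x) *\<^sub>R d) / norm (y - x)" if "y \<noteq> x" for y
      proof -
        have "cmod (h y - h x) / \<bar>y - x\<bar> - 1 = (cmod (h y - h x) - cmod ((y - x) *\<^sub>R d)) / \<bar>y - x\<bar>"
          using that \<open>cmod d = 1\<close> by (simp add: diff_divide_distrib)
        then show ?thesis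
          using norm_triangle_ineq3[of "h y - h x" "(y - x) *\<^sub>R d"] by (simp add: divide_right_mono)
      qed
      then show "eventually (\<lambda>y. norm (cmod (h y - h x) / \<bar>y - x\<bar> - 1) \<le> cmod (h y - h x - (y - x) *\<^sub>R d) / norm (y - x)) (at x)"
        by (simp add: eventually_at_filter)
    qed
    then show ?thesis by (rule LIM_zero_cancel)
  qed
  have dphi: "(\<phi> has_real_derivative 1) (at t within {a..b})" if t: "t \<in> {a..b}" for t
  proof -
    let ?F = "at t within {a..b}"
    have inA: "eventually (\<lambda>y. y \<in> {a..b} \<and> y \<noteq> t) ?F" by (simp add: eventually_at_filter)
    have ne: "\<phi> y \<noteq> \<phi> t" if "y \<in> {a..b}" "y \<noteq> t" for y
      using \<phi>(2) t that by (metis inj_onD strict_mono_on_imp_inj_on)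
    have 1: "((\<lambda>y. cmod (f y - f t) / \<bar>y - t\<bar>) \<longlongrightarrow> 1) ?F"
      using quot[OF f] by (rule tendsto_within_subset) simp
    \<comment> \<open>Injectivity keeps \<open>\<phi> y\<close> different from
      \<open>\<phi> t\<close>, as the punctured limit for \<open>g\<close> requires.\<close>
    have "filterlim \<phi> (at (\<phi> t)) ?F"
      unfolding filterlim_at using \<phi>(1) t inA ne
      by (auto simp: continuous_on_def elim!: eventually_mono)
    from filterlim_compose[OF quot[OF g, of "\<phi> t"] this]
    have 2: "((\<lambda>y. cmod (g (\<phi> y) - g (\<phi> t)) / \<bar>\<phi> y - \<phi> t\<bar>) \<longlongrightarrow> 1) ?F" .
    have "eventually (\<lambda>y. 0 < cmod (f y - f t) / \<bar>y - t\<bar>) ?F"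
      using order_tendstoD(1)[OF 1, of 0] by simp
    with inA have ev: "eventually (\<lambda>y. (cmod (f y - f t) / \<bar>y - t\<bar>) / (cmod (g (\<phi> y) - g (\<phi> t)) / \<bar>\<phi> y - \<phi> t\<bar>) = (\<phi> y - \<phi> t) / (y - t)) ?F"
    proof eventually_elim
      case (elim y)
      have "\<bar>\<phi> y - \<phi> t\<bar> / \<bar>y - t\<bar> = (\<phi> y - \<phi> t) / (y - t)"
      proof (cases "y < t")
        case True
        then have "\<phi> y < \<phi> t" using strict_mono_onD[OF \<phi>(2), of y t] elim t by auto
        then show ?thesis using True by (simp add: abs_if divide_simps algebra_simps)
      next
        case False
        then have "\<phi> t < \<phi> y" using strict_mono_onD[OF \<phi>(2), of t y] elim t by auto
        then show ?thesis using False by (simp add: abs_if)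
      qed
      moreover have "f y = g (\<phi> y)" "f t = g (\<phi> t)" using eq elim t by auto
      moreover have "cmod (f y - f t) \<noteq> 0" using elim by auto
      ultimately show ?case by simp
    qed
    have "((\<lambda>y. (\<phi> y - \<phi> t) / (y - t)) \<longlongrightarrow> 1 / 1) ?F"
      using tendsto_divide[OF 1 2] by (rule Lim_transform_eventually) (use ev in simp_all)
    then show ?thesis by (simp add: has_field_derivative_iff)
  qed
  have "((\<lambda>x. \<phi> x - x) has_real_derivative 0) (at t within {a..b})" if "t \<in> {a..b}" for t
    using DERIV_diff[OF dphi[OF that] DERIV_ident] by simp
  then obtain k where "\<And>x. x \<in> {a..b} \<Longrightarrow> \<phi> x - x = k"
    using has_field_derivative_zero_constant[of "{a..b}" "\<lambda>x. \<phi> x - x"] by auto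
  from this[of x] this[of a] x show ?thesis by auto
qed

lemma (in periodic_unit_speed) per_T_int: "T (s + of_int n * L) = T s"
proof (induction n rule: int_induct[of _ 0])
  case (step1 i)
  then show ?case using per_T[of "s + of_int i * L"] by (simp add: algebra_simps)
next
  case (step2 i)
  then show ?case using per_T[of "s + of_int (i - 1) * L"] by (simp add: algebra_simps)
qed simp

section \<open>Comparison of two curves\<close>

context tgl_loop
begin

lemma prev_next: "prev_exit (next_exit s) = s"
  using next_prev[of "next_exit s"] strict_mono_eq[OF strict_mono_next] by simp

lemma strict_mono_prev: "strict_mono prev_exit"
  by (rule strict_monoI) (metis next_prev strict_mono_less strict_mono_next)

text \<open>A strictly increasing surjection of the line is continuous.\<close>

lemma cont_next: "continuous_on A next_exit"
proof -
  have "range next_exit = UNIV" using next_prev by (metis surjI)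
  then have "continuous_on UNIV next_exit"
    using strict_mono_next by (intro continuous_onI_mono) (auto simp: strict_mono_less_eq)
  then show ?thesis using continuous_on_subset by blast
qed

lemma cont_prev: "continuous_on A prev_exit"
proof -
  have "range prev_exit = UNIV" using prev_next by (metis surjI)
  then have "continuous_on UNIV prev_exit"
    using strict_mono_prev by (intro continuous_onI_mono) (auto simp: strict_mono_less_eq)
  then show ?thesis using continuous_on_subset by blast
qed

lemma fwd_mono:
  assumes "0 < r" "r \<le> R"
  shows "fwd s r \<le> fwd s R"
proof (rule ccontr)
  assume "\<not> fwd s r \<le> fwd s R"
  then have "fwd s R \<in> {0..<fwd s r}" using arc_bounds[OF R_pos order_refl, of s] by simp
  then have "cmod (\<gamma> (s + fwd s R) - \<gamma> s) < r"
    using two_arc_fwd_bwd[OF assms, of s] by (auto simp: two_arc_def)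
  then show False using arc_bounds[OF R_pos order_refl, of s] assms by simp
qed

text \<open>Every point of the forward arc is itself the exit point of a disk of radius at most
  \<open>R\<close>, so the exit points for these radii sweep out the arc.\<close>

lemma fwd_chord:
  assumes "0 < x" "x \<le> fwd s R"
  shows "0 < cmod (\<gamma> (s + x) - \<gamma> s)" "cmod (\<gamma> (s + x) - \<gamma> s) \<le> R" "fwd s (cmod (\<gamma> (s + x) - \<gamma> s)) = x"
proof -
  let ?r = "cmod (\<gamma> (s + x) - \<gamma> s)"
  have xL: "x < L" using assms arc_bounds[OF R_pos order_refl, of s] by simp
  show p: "0 < ?r" using inj[of "s + x" s] assms xL by auto
  show q: "?r \<le> R" using arc_le[OF R_pos order_refl, of x s] assms xL by simp
  have inj': "inj_on (\<lambda>x. cmod (\<gamma> (s + x) - \<gamma> s)) {0..fwd s R}"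
    using mono_fwd[OF R_pos order_refl, of s] by (rule strict_mono_on_imp_inj_on)
  show "fwd s ?r = x"
    using inj_onD[OF inj', of "fwd s ?r" x] arc_bounds[OF p q, of s] fwd_mono[OF p q, of s] assms by simp
qed

text \<open>Rotating by \<open>cnj (T s)\<close> and scaling by \<open>1 / r\<close> turns the
  intersection points into the pairs of \<open>unit_pair_determined\<close>. The radial derivative
  fixes their ratio, the derivative along the curve fixes the difference of the imaginary parts, and
  the tangent lemmas give the signs.\<close>

lemma same_exit_direction:
  assumes B: "tgl_loop L \<gamma>' T' R"
    and ccw: "ccw_arclength_boundary \<Omega> L \<gamma>" "ccw_arclength_boundary \<Omega>' L \<gamma>'"
    and r: "0 < r" "r \<le> R" and s: "s \<in> {0..L}"
    and ds: "disk_area_ds \<Omega> L \<gamma> s r = disk_area_ds \<Omega>' L \<gamma>' s r"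
    and dr: "disk_area_dr \<Omega> \<gamma> s r = disk_area_dr \<Omega>' \<gamma>' s r"
  shows "cnj (T s) * (\<gamma> (s + fwd s r) - \<gamma> s) = cnj (T' s) * (\<gamma>' (s + periodic_unit_speed.fwd L \<gamma>' s r) - \<gamma>' s)"
proof -
  interpret B: tgl_loop L \<gamma>' T' R by (rule B)
  note A1 = two_arc_fwd_bwd[OF r, of s] and A2 = arc_bounds[OF r, of s]
  note B1 = B.two_arc_fwd_bwd[OF r, of s] and B2 = B.arc_bounds[OF r, of s]
  define u1 where "u1 = cnj (T s) * (\<gamma> (s + fwd s r) - \<gamma> s) / r"
  define u2 where "u2 = cnj (T s) * (\<gamma> (s + bwd s r) - \<gamma> s) / r"
  define v1 where "v1 = cnj (T' s) * (\<gamma>' (s + B.fwd s r) - \<gamma>' s) / r"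
  define v2 where "v2 = cnj (T' s) * (\<gamma>' (s + B.bwd s r) - \<gamma>' s) / r"
  have re: "Re (cnj t * w / of_real r) = (w \<bullet> t) / r" for t w :: complex
    by (simp add: inner_complex_def mult.commute)
  have T0: "T s \<noteq> 0" "T' s \<noteq> 0" using norm_T[of s] B.norm_T[of s] by auto
  have "u1 = v1"
  proof (rule unit_pair_determined[of u1 v1 u2 v2])
    show "cmod u1 = 1" "cmod v1 = 1"
      using A2 B2 r by (simp_all add: u1_def v1_def norm_mult norm_divide norm_T B.norm_T)
    show "0 < Re u1" "Re u2 < 0" "0 < Re v1" "Re v2 < 0"
      unfolding u1_def u2_def v1_def v2_def re
      using fwd_tangent_pos[OF r, of "fwd s r" s] bwd_tangent_neg[OF r, of s "bwd s r"]
        B.fwd_tangent_pos[OF r, of "B.fwd s r" s] B.bwd_tangent_neg[OF r, of s "B.bwd s r"] A2 B2 r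
      by (simp_all add: divide_less_0_iff)
    show "u2 / u1 = v2 / v1"
      using disk_area_has_derivative_radius[OF ccw(1) r(1) s A1] B.disk_area_has_derivative_radius[OF ccw(2) r(1) s B1] dr r T0
      by (simp add: u1_def u2_def v1_def v2_def)
    have "u2 - u1 = cnj (T s) * (\<gamma> (s + bwd s r) - \<gamma> (s + fwd s r)) / r"
      "v2 - v1 = cnj (T' s) * (\<gamma>' (s + B.bwd s r) - \<gamma>' (s + B.fwd s r)) / r"
      by (simp_all add: u1_def u2_def v1_def v2_def algebra_simps diff_divide_distrib)
    then show "Im (u2 - u1) = Im (v2 - v1)"
      using disk_area_has_derivative_arclength[OF ccw(1) r(1) s A1] B.disk_area_has_derivative_arclength[OF ccw(2) r(1) s B1] ds
      by (simp only: Im_divide_of_real)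
  qed
  then show ?thesis using r by (simp add: u1_def v1_def)
qed

text \<open>Offsets of equal chord length on the two arcs correspond under an increasing map
  \<open>\<phi>\<close> that matches the points; rigidity and \<open>\<phi> 0 = 0\<close> make it
  the identity.\<close>

lemma initial_arc_eq:
  assumes B: "tgl_loop L \<gamma>' T' R"
    and eq: "\<And>r. 0 < r \<Longrightarrow> r \<le> R \<Longrightarrow> \<gamma> (a + fwd a r) = \<gamma>' (a + periodic_unit_speed.fwd L \<gamma>' a r)"
    and base: "\<gamma> a = \<gamma>' a"
  shows "next_exit a = tgl_loop.next_exit L \<gamma>' R a" "\<And>t. t \<in> {a..next_exit a} \<Longrightarrow> \<gamma> t = \<gamma>' t"
proof -
  interpret B: tgl_loop L \<gamma>' T' R by (rule B)
  define d where "d x = cmod (\<gamma> (a + x) - \<gamma> a)" for x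
  define d' where "d' x = cmod (\<gamma>' (a + x) - \<gamma>' a)" for x
  let ?b = "fwd a R" and ?b' = "B.fwd a R"
  define \<phi> where "\<phi> x = the_inv_into {0..?b'} d' (d x)" for x
  note bd = arc_bounds[OF R_pos order_refl, of a] and bd' = B.arc_bounds[OF R_pos order_refl, of a]
  have cd: "continuous_on A d" "continuous_on A d'" for A
    unfolding d_def d'_def
    by (auto intro!: continuous_intros continuous_on_compose2[OF cont[of UNIV]] continuous_on_compose2[OF B.cont[of UNIV]])
  have md: "strict_mono_on {0..?b} d" "strict_mono_on {0..?b'} d'"
    using mono_fwd[OF R_pos order_refl, of a] B.mono_fwd[OF R_pos order_refl, of a] by (simp_all add: d_def[abs_def] d'_def[abs_def])
  have inj': "inj_on d' {0..?b'}" using md(2) by (rule strict_mono_on_imp_inj_on)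
  have dR: "d x \<in> {0..R}" if "x \<in> {0..?b}" for x
    using fwd_chord[of x a] that R_pos by (cases "x = 0") (auto simp: d_def)
  have im: "d' ` {0..?b'} \<supseteq> {0..R}"
  proof
    fix y assume "y \<in> {0..R}"
    then show "y \<in> d' ` {0..?b'}"
      using IVT'[of d' 0 y ?b'] bd' cd by (auto simp: d'_def image_iff)
  qed
  have \<phi>in: "\<phi> x \<in> {0..?b'}" "d' (\<phi> x) = d x" if "x \<in> {0..?b}" for x
    using dR[OF that] im inj' the_inv_into_into[OF inj', of "d x" "{0..?b'}"] f_the_inv_into_f[OF inj', of "d x"]
    by (auto simp: \<phi>_def)
  have \<phi>0: "\<phi> 0 = 0"
    unfolding \<phi>_def by (rule the_inv_into_f_eq[OF inj']) (use bd' in \<open>auto simp: d_def d'_def\<close>)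
  have \<phi>fwd: "\<phi> x = B.fwd a (d x)" if "0 < x" "x \<le> ?b" for x
  proof -
    have r: "0 < d x" "d x \<le> R" using fwd_chord[OF that] by (auto simp: d_def)
    show ?thesis
      unfolding \<phi>_def
      by (rule the_inv_into_f_eq[OF inj']) (use B.arc_bounds[OF r, of a] B.fwd_mono[OF r, of a] in \<open>auto simp: d'_def\<close>)
  qed
  have c\<phi>: "continuous_on {0..?b} \<phi>"
    unfolding \<phi>_def
    by (rule continuous_on_compose2[OF continuous_on_inv_into[OF cd(2) compact_Icc inj'] cd(1)]) (use dR im in auto)
  have m\<phi>: "strict_mono_on {0..?b} \<phi>"
  proof (rule strict_mono_onI)
    fix x y assume xy: "x \<in> {0..?b}" "y \<in> {0..?b}" "x < y"
    then have "d' (\<phi> x) < d' (\<phi> y)" using \<phi>in(2) strict_mono_onD[OF md(1)] by auto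
    then show "\<phi> x < \<phi> y" using strict_mono_on_less[OF md(2)] \<phi>in(1) xy by blast
  qed
  have g: "\<gamma> (a + x) = \<gamma>' (a + \<phi> x)" if "x \<in> {0..?b}" for x
  proof (cases "x = 0")
    case True then show ?thesis using base \<phi>0 by simp
  next
    case False
    then have x: "0 < x" "x \<le> ?b" using that by auto
    then show ?thesis
      using eq[of "d x"] fwd_chord[OF x] \<phi>fwd[OF x] by (simp add: d_def)
  qed
  have \<phi>id: "\<phi> x = x" if "x \<in> {0..?b}" for x
    using reparametrization_rigid[OF has_vector_derivative_shift norm_T B.has_vector_derivative_shift B.norm_T c\<phi> m\<phi> g that] \<phi>0 by simp
  have "?b = ?b'" using \<phi>id[of ?b] \<phi>fwd[of ?b] bd by (simp add: d_def)
  then show "next_exit a = B.next_exit a" by (simp add: next_exit_def B.next_exit_def)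
  show "\<gamma> t = \<gamma>' t" if "t \<in> {a..next_exit a}" for t
    using g[of "t - a"] \<phi>id[of "t - a"] that by (simp add: next_exit_def)
qed

text \<open>Suppose the curves agree up to \<open>t0\<close>. Their tangents agree there too, so by
  \<open>slide\<close> the exit points of the disks centred on this part coincide. Together with the
  initial arc they fill the curve up to \<open>next_exit t0\<close>, and rigidity identifies the
  parameters.\<close>

lemma sliding:
  assumes B: "tgl_loop L \<gamma>' T' R"
    and init: "next_exit a = tgl_loop.next_exit L \<gamma>' R a" "\<And>t. t \<in> {a..next_exit a} \<Longrightarrow> \<gamma> t = \<gamma>' t"
    and slide: "\<And>s. cnj (T s) * (\<gamma> (next_exit s) - \<gamma> s) = cnj (T' s) * (\<gamma>' (tgl_loop.next_exit L \<gamma>' R s) - \<gamma>' s)"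
    and t: "a \<le> t"
  shows "\<gamma> t = \<gamma>' t"
proof -
  interpret B: tgl_loop L \<gamma>' T' R by (rule B)
  have step: "\<gamma> t = \<gamma>' t" if t0: "next_exit a \<le> t0" and ag: "\<And>t. t \<in> {a..t0} \<Longrightarrow> \<gamma> t = \<gamma>' t" and t: "t \<in> {a..next_exit t0}" for t t0
  proof (cases "t \<le> next_exit a")
    case True then show ?thesis using init(2) t by simp
  next
    case False
    have at0: "a < t0" using t0 exit_bounds(1)[of a] by simp
    have TT: "T s = T' s" if s: "s \<in> {a..t0}" for s
    proof -
      have "(\<gamma> has_vector_derivative T s) (at s within {a..t0})" using deriv by (rule has_vector_derivative_at_within)
      moreover have "(\<gamma> has_vector_derivative T' s) (at s within {a..t0})"
        by (rule has_vector_derivative_transform[OF s _ has_vector_derivative_at_within[OF B.deriv]]) (use ag in auto)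
      ultimately show ?thesis
        using vector_derivative_unique_within_closed_interval[of a t0 s \<gamma> "T s" "T' s"] at0 s by simp
    qed
    \<comment> \<open>Exit points with the same centre are matched: \<open>prev_exit\<close>
      recovers the centre from the first curve, and \<open>B.next_exit\<close> gives the exit on the
      second.\<close>
    define \<phi> where "\<phi> t = B.next_exit (prev_exit t)" for t
    let ?I = "{next_exit a..next_exit t0}"
    have prev: "prev_exit t \<in> {a..t0}" if "t \<in> ?I" for t
      using that prev_next strict_mono_less_eq[OF strict_mono_prev] by (metis atLeastAtMost_iff)
    have c\<phi>: "continuous_on ?I \<phi>"
      unfolding \<phi>_def by (rule continuous_on_compose2[OF B.cont_next[of UNIV] cont_prev]) simp
    have m\<phi>: "strict_mono_on ?I \<phi>"
      unfolding \<phi>_def using strict_mono_prev B.strict_mono_next by (intro strict_mono_onI) (auto simp: strict_mono_less)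
    have g: "\<gamma> t = \<gamma>' (\<phi> t)" if "t \<in> ?I" for t
    proof -
      have s: "prev_exit t \<in> {a..t0}" using prev[OF that] .
      have "T' (prev_exit t) \<noteq> 0" using B.norm_T[of "prev_exit t"] by auto
      then show ?thesis using slide[of "prev_exit t"] TT[OF s] ag[OF s] by (simp add: \<phi>_def next_prev)
    qed
    have "t \<in> ?I" using False t by auto
    \<comment> \<open>The initial arc provides a fixed point of \<open>\<phi>\<close>, so the
      constant shift is 0.\<close>
    have "\<phi> (next_exit a) = next_exit a"
      unfolding \<phi>_def prev_next using init(1) by simp
    then have "\<phi> t = t"
      using reparametrization_rigid[OF deriv norm_T B.deriv B.norm_T c\<phi> m\<phi> g \<open>t \<in> ?I\<close>] by simp
    then show ?thesis using g[OF \<open>t \<in> ?I\<close>] by simp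
  qed
  \<comment> \<open>Each slide extends the known part by at least \<open>R\<close>.\<close>
  have "\<exists>t0. next_exit a \<le> t0 \<and> a + real n * R \<le> t0 \<and> (\<forall>t\<in>{a..t0}. \<gamma> t = \<gamma>' t)" for n
  proof (induction n)
    case 0
    show ?case using init(2) exit_bounds(1)[of a] by (intro exI[of _ "next_exit a"]) auto
  next
    case (Suc n)
    then obtain t0 where t0: "next_exit a \<le> t0" "a + real n * R \<le> t0" "\<forall>t\<in>{a..t0}. \<gamma> t = \<gamma>' t" by blast
    show ?case
    proof (intro exI[of _ "next_exit t0"] conjI ballI)
      show "next_exit a \<le> next_exit t0" using t0(1) exit_bounds(1)[of t0] by simp
      show "a + real (Suc n) * R \<le> next_exit t0" using t0(2) next_exit_ge[of t0] by (simp add: algebra_simps)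
      show "\<gamma> t = \<gamma>' t" if "t \<in> {a..next_exit t0}" for t using step[OF t0(1) _ that] t0(3) by blast
    qed
  qed
  moreover obtain n where "t - a < real n * R" using reals_Archimedean3[OF R_pos] by blast
  ultimately obtain t0 where "t \<le> t0" "\<forall>t\<in>{a..t0}. \<gamma> t = \<gamma>' t" by (smt (verit))
  then show ?thesis using t by simp
qed

end


section \<open>Passage to periodic curves and conclusion\<close>

lemma simple_path_cong:
  assumes "\<And>t. t \<in> {0..1} \<Longrightarrow> p t = q t"
  shows "simple_path p \<longleftrightarrow> simple_path q"
proof -
  have "continuous_on {0..1} p \<longleftrightarrow> continuous_on {0..1} q"
    using assms by (intro continuous_on_cong) auto
  then show ?thesis using assms by (simp add: simple_path_def path_def loop_free_def)
qed

text \<open>The conditions on the curve concern its values on \<open>{0..L}\<close>, so the periodic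
  extension inherits them; its range is covered by one period.\<close>

lemma ccw_arclength_boundary_extension:
  assumes ccw: "ccw_arclength_boundary \<Omega> L \<gamma>0"
  obtains \<gamma> T where "periodic_unit_speed L \<gamma> T" "\<And>s. s \<in> {0..L} \<Longrightarrow> \<gamma> s = \<gamma>0 s"
    "ccw_arclength_boundary \<Omega> L \<gamma>" "range \<gamma> = frontier \<Omega>"
proof -
  obtain \<gamma> T where P: "periodic_unit_speed L \<gamma> T" and eq: "\<And>s. s \<in> {0..L} \<Longrightarrow> \<gamma> s = \<gamma>0 s"
    using periodic_extension[of L \<gamma>0] ccw unfolding ccw_arclength_boundary_def by blast
  interpret periodic_unit_speed L \<gamma> T by (rule P)
  have u: "unit_rescale L \<gamma> t = unit_rescale L \<gamma>0 t" if "t \<in> {0..1}" for t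
    using that L_pos by (auto simp: unit_rescale_def intro!: eq mult_left_le)
  have "C1_arclength_loop L \<gamma>"
    unfolding C1_arclength_loop_def
    using L_pos per[of 0] per_T[of 0] norm_T cont_T_on has_vector_derivative_at_within[OF deriv]
    by (auto intro!: exI[of _ T])
  moreover have pim: "path_image (unit_rescale L \<gamma>) = frontier \<Omega>"
    using ccw u by (auto simp: ccw_arclength_boundary_def path_image_def)
  moreover have "simple_path (unit_rescale L \<gamma>)"
    using ccw simple_path_cong[OF u] by (simp add: ccw_arclength_boundary_def)
  moreover have "winding_number (unit_rescale L \<gamma>) z = winding_number (unit_rescale L \<gamma>0) z" for z
    by (rule winding_number_cong) (use u in auto)
  ultimately have "ccw_arclength_boundary \<Omega> L \<gamma>"
    using ccw by (simp add: ccw_arclength_boundary_def)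
  then show thesis using that P eq pim range_eq_path_image by simp
qed

lemma disk_area_derivatives_cong:
  assumes eq: "\<And>s. s \<in> {0..L} \<Longrightarrow> \<gamma> s = \<gamma>0 s" and s: "s \<in> {0..L}"
  shows "disk_area_ds \<Omega> L \<gamma> s r = disk_area_ds \<Omega> L \<gamma>0 s r" "disk_area_dr \<Omega> \<gamma> s r = disk_area_dr \<Omega> \<gamma>0 s r"
proof -
  show "disk_area_ds \<Omega> L \<gamma> s r = disk_area_ds \<Omega> L \<gamma>0 s r"
    unfolding disk_area_ds_def
    by (rule vector_derivative_cong_eq) (use s eq in \<open>auto simp: disk_area_def\<close>)
  show "disk_area_dr \<Omega> \<gamma> s r = disk_area_dr \<Omega> \<gamma>0 s r"
    unfolding disk_area_dr_def disk_area_def using eq[OF s] by simp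
qed

lemma tgl_loop_rigid_motion:
  assumes "tgl_loop L \<gamma> T R" and e: "cmod e = 1"
  shows "tgl_loop L (\<lambda>s. c + e * \<gamma> s) (\<lambda>s. e * T s) R"
proof -
  interpret tgl_loop L \<gamma> T R by fact
  have e0: "e \<noteq> 0" using e by auto
  interpret P: periodic_unit_speed L "\<lambda>s. c + e * \<gamma> s" "\<lambda>s. e * T s"
  proof
    show "((\<lambda>s. c + e * \<gamma> s) has_vector_derivative e * T s) (at s)" for s
      using has_vector_derivative_add[OF has_vector_derivative_const has_vector_derivative_mult_right[OF deriv]] by simp
  qed (use L_pos cont_T norm_T per per_T inj e0 e in \<open>auto simp: norm_mult intro!: continuous_intros\<close>)
  have in_e: "(e * z) \<bullet> (e * w) = z \<bullet> w" for z w
  proof -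
    have "Re e * Re e + Im e * Im e = 1"
      using e by (simp add: cmod_def power2_eq_square)
    then show ?thesis unfolding inner_complex_def by simp algebra
  qed
  have "P.transversal R"
    unfolding P.transversal_def
  proof (intro allI impI)
    fix s t
    assume h: "cmod (c + e * \<gamma> s - (c + e * \<gamma> t)) \<le> R" "(c + e * \<gamma> s - (c + e * \<gamma> t)) \<bullet> (e * T t) = 0"
    have d: "c + e * \<gamma> s - (c + e * \<gamma> t) = e * (\<gamma> s - \<gamma> t)" by (simp add: algebra_simps)
    have "\<gamma> s = \<gamma> t"
      using trans h unfolding d in_e transversal_def by (simp add: norm_mult e)
    then show "c + e * \<gamma> s = c + e * \<gamma> t" by simp
  qed
  then show ?thesis using R_pos by unfold_locales
qed

theorem lemma4p5p1:
  fixes \<Omega>\<^sub>1 \<Omega>\<^sub>2 :: "complex set" and \<gamma>\<^sub>1 \<gamma>\<^sub>2 :: "real \<Rightarrow> complex" and L rhat shat :: real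
  assumes "ccw_arclength_boundary \<Omega>\<^sub>1 L \<gamma>\<^sub>1"
    and "ccw_arclength_boundary \<Omega>\<^sub>2 L \<gamma>\<^sub>2"
    and "0 < rhat"
    and "TGL (frontier \<Omega>\<^sub>1) rhat"
    and "TGL (frontier \<Omega>\<^sub>2) rhat"
    and "shat \<in> {0..L}"
    and "\<And>s r. (s, r) \<in> ({0..L} \<times> {rhat}) \<union> ({shat} \<times> {0<..rhat}) \<Longrightarrow>
           disk_area \<Omega>\<^sub>1 \<gamma>\<^sub>1 s r = disk_area \<Omega>\<^sub>2 \<gamma>\<^sub>2 s r \<and>
           disk_area_ds \<Omega>\<^sub>1 L \<gamma>\<^sub>1 s r = disk_area_ds \<Omega>\<^sub>2 L \<gamma>\<^sub>2 s r \<and>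
           disk_area_dr \<Omega>\<^sub>1 \<gamma>\<^sub>1 s r = disk_area_dr \<Omega>\<^sub>2 \<gamma>\<^sub>2 s r"
  shows "\<exists>\<phi> \<theta> c. reparametrization L \<phi> \<and>
           (\<forall>s\<in>{0..L}. \<gamma>\<^sub>2 s = c + cis \<theta> * \<gamma>\<^sub>1 (\<phi> s))"
proof -
  obtain \<gamma> T where P: "periodic_unit_speed L \<gamma> T" and eq: "\<And>s. s \<in> {0..L} \<Longrightarrow> \<gamma> s = \<gamma>\<^sub>1 s"
    and ccw: "ccw_arclength_boundary \<Omega>\<^sub>1 L \<gamma>" and fr: "range \<gamma> = frontier \<Omega>\<^sub>1"
    using ccw_arclength_boundary_extension[OF assms(1)] by metis
  obtain \<gamma>' T' where P': "periodic_unit_speed L \<gamma>' T'" and eq': "\<And>s. s \<in> {0..L} \<Longrightarrow> \<gamma>' s = \<gamma>\<^sub>2 s"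
    and ccw': "ccw_arclength_boundary \<Omega>\<^sub>2 L \<gamma>'" and fr': "range \<gamma>' = frontier \<Omega>\<^sub>2"
    using ccw_arclength_boundary_extension[OF assms(2)] by metis
  have "tgl_loop L \<gamma> T rhat"
    using P periodic_unit_speed.TGL_imp_transversal[OF P, of rhat] assms(3,4)
    by (simp add: tgl_loop_def tgl_loop_axioms_def fr)
  then interpret A: tgl_loop L \<gamma> T rhat .
  have B: "tgl_loop L \<gamma>' T' rhat"
    using P' periodic_unit_speed.TGL_imp_transversal[OF P', of rhat] assms(3,5)
    by (simp add: tgl_loop_def tgl_loop_axioms_def fr')
  then interpret B: tgl_loop L \<gamma>' T' rhat .
  have T0: "T s \<noteq> 0" "T' s \<noteq> 0" for s using A.norm_T[of s] B.norm_T[of s] by auto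
  have dir: "cnj (T s) * (\<gamma> (s + A.fwd s r) - \<gamma> s) = cnj (T' s) * (\<gamma>' (s + B.fwd s r) - \<gamma>' s)"
    if "(s, r) \<in> ({0..L} \<times> {rhat}) \<union> ({shat} \<times> {0<..rhat})" for s r
  proof (rule A.same_exit_direction[OF B ccw ccw'])
    show s: "s \<in> {0..L}" and "0 < r" "r \<le> rhat" using that assms(3,6) by auto
    show "disk_area_ds \<Omega>\<^sub>1 L \<gamma> s r = disk_area_ds \<Omega>\<^sub>2 L \<gamma>' s r" "disk_area_dr \<Omega>\<^sub>1 \<gamma> s r = disk_area_dr \<Omega>\<^sub>2 \<gamma>' s r"
      using assms(7)[OF that] disk_area_derivatives_cong[OF eq s] disk_area_derivatives_cong[OF eq' s] by simp_all
  qed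
  \<comment> \<open>The rigid motion carries point and tangent of the first curve at
    \<open>shat\<close> to those of the second.\<close>
  define e where "e = T' shat / T shat"
  define c where "c = \<gamma>' shat - e * \<gamma> shat"
  have e: "cmod e = 1" by (simp add: e_def norm_divide A.norm_T B.norm_T)
  define \<gamma>r where "\<gamma>r = (\<lambda>s. c + e * \<gamma> s)"
  define Tr where "Tr = (\<lambda>s. e * T s)"
  interpret C: tgl_loop L \<gamma>r Tr rhat
    unfolding \<gamma>r_def Tr_def using A.tgl_loop_axioms e by (rule tgl_loop_rigid_motion)
  have diff: "\<gamma>r s - \<gamma>r t = e * (\<gamma> s - \<gamma> t)" for s t by (simp add: \<gamma>r_def algebra_simps)
  have fwd: "C.fwd s r = A.fwd s r" for s r
    by (simp add: C.fwd_def A.fwd_def C.two_arc_def A.two_arc_def diff norm_mult e)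
  have "cnj e * e = 1" using e complex_norm_square[of e] by (simp add: mult.commute)
  then have rot: "cnj (Tr s) * (\<gamma>r t - \<gamma>r s) = cnj (T s) * (\<gamma> t - \<gamma> s)" for s t
    unfolding diff Tr_def complex_cnj_mult by (metis mult.assoc mult.left_commute mult_1)
  have base: "\<gamma>r shat = \<gamma>' shat" "Tr shat = T' shat"
    using T0 by (simp_all add: \<gamma>r_def c_def Tr_def e_def)
  have init: "\<gamma>r (shat + C.fwd shat r) = \<gamma>' (shat + B.fwd shat r)" if "0 < r" "r \<le> rhat" for r
    using dir[of shat r] rot[of shat "shat + A.fwd shat r"] that base T0[of shat] by (simp add: fwd)
  \<comment> \<open>The data cover centres in \<open>{0..L}\<close>, while sliding runs past
    \<open>L\<close>; reduction modulo \<open>L\<close> extends the identity to every real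
    \<open>s\<close>.\<close>
  have slide: "cnj (Tr s) * (\<gamma>r (C.next_exit s) - \<gamma>r s) = cnj (T' s) * (\<gamma>' (B.next_exit s) - \<gamma>' s)" for s
  proof -
    define n where "n = \<lfloor>s / L\<rfloor>"
    define x where "x = s - of_int n * L"
    have sx: "s = x + of_int n * L" by (simp add: x_def)
    have x: "x \<in> {0..L}"
      using floor_divide_lower[OF A.L_pos, of s] floor_divide_upper[OF A.L_pos, of s] by (auto simp: x_def n_def algebra_simps)
    have TL: "T (x + of_int n * L) = T x" "T' (x + of_int n * L) = T' x"
      by (rule A.per_T_int, rule B.per_T_int)
    have f: "A.fwd s rhat = A.fwd x rhat" "B.fwd s rhat = B.fwd x rhat"
      by (simp_all add: A.fwd_def B.fwd_def sx A.two_arc_shift B.two_arc_shift)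
    have g: "\<gamma> (x + of_int n * L + y) = \<gamma> (x + y)" "\<gamma>' (x + of_int n * L + y) = \<gamma>' (x + y)" for y
      using A.per_int[of "x + y" n] B.per_int[of "x + y" n] by (simp_all add: add_ac)
    show ?thesis
      using dir[of x rhat] x g[of 0]
      unfolding rot C.next_exit_def B.next_exit_def fwd f by (simp add: sx TL g)
  qed
  note ini = C.initial_arc_eq[OF B init base(1)]
  \<comment> \<open>Sliding proceeds forwards from \<open>shat\<close>, so it is applied at
    \<open>s + L\<close>, which is at least \<open>shat\<close>; periodicity returns to
    \<open>s\<close>.\<close>
  have agree: "\<gamma>r s = \<gamma>' s" if "s \<in> {0..L}" for s
    using C.sliding[OF B ini slide, of "s + L"] that assms(6) C.per[of s] B.per[of s] by simp
  obtain \<theta> where \<theta>: "e = cis \<theta>" using e complex_norm_eq_1_exp cis_conv_exp by metis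
  show ?thesis
  proof (intro exI conjI ballI)
    \<comment> \<open>After alignment at \<open>shat\<close> the arclength parameters agree, so the
      identity serves as reparametrization.\<close>
    show "reparametrization L (\<lambda>s. s)"
      by (auto simp: reparametrization_def strict_mono_on_def intro!: continuous_intros)
    show "\<gamma>\<^sub>2 s = c + cis \<theta> * \<gamma>\<^sub>1 s" if "s \<in> {0..L}" for s
      using agree[OF that] eq[OF that] eq'[OF that] by (simp add: \<gamma>r_def \<theta>)
  qed
qed

end
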